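(* (1) Let $\Omega=\{z\in\mathbb{C}^n \mid r(z)<0\}$ be a bounded domain with $C^2$-smooth boundary, where $r$ is a $C^2$ defining function with $dr\ne0$ on $b\Omega$. If there exist constants $C>0$ and $\alpha>1/2$ such that \[ F^K_\Omega(z,X)\ge C\frac{|\langle\partial r(z),X\rangle|}{|r(z)|^{\alpha}} \] for all $z\in\Omega$ and all $X\in\mathbb{C}^n$, then $\Omega$ is pseudoconvex. (2) Conversely, if $\Omega=\{z\in\mathbb{C}^n \mid r(z)<0\}$ is a bounded pseudoconvex domain with $C^3$-smooth boundary, where $r$ is a $C^3$ defining function with $dr\ne 0$ on $b\Omega$, then there exists a constant $C>0$ such that \[ F^K_\Omega(z,X)\ge C\frac{|\langle\partial r(z),X\rangle|}{|r(z)|^{2/3}} \] for all $z\in\Omega$ and all $X\in\mathbb{C}^n$.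
   Context: $\langle\partial r(z),X\rangle=\sum_{j=1}^n \frac{\partial r}{\partial z_j}(z)X_j$. For a domain $\Omega\subset\mathbb{C}^n$, $z\in\Omega$ and $X\in\mathbb{C}^n$, the Kobayashi(–Royden) metric is $F^K_\Omega(z,X)=\inf\{1/\lambda \mid \exists f\colon D\to\Omega \text{ holomorphic},\ f(0)=z,\ f'(0)=\lambda X,\ \lambda>0\}$, where $D$ is the unit disc in $\mathbb{C}$. *)

theory Defs
  imports "HOL-Analysis.Analysis"
begin

fun Ck_on :: "nat \<Rightarrow> ('a::euclidean_space \<Rightarrow> real) \<Rightarrow> 'a set \<Rightarrow> bool" where
  "Ck_on 0 f U = continuous_on U f"
| "Ck_on (Suc k) f U =
     (\<exists>f'. (\<forall>x\<in>U. (f has_derivative f' x) (at x)) \<and> (\<forall>v. Ck_on k (\<lambda>x. f' x v) U))"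

definition dx :: "(complex^'n \<Rightarrow> real) \<Rightarrow> complex^'n \<Rightarrow> 'n \<Rightarrow> real" where
  "dx r z j = frechet_derivative r (at z) (axis j 1)"

definition dy :: "(complex^'n \<Rightarrow> real) \<Rightarrow> complex^'n \<Rightarrow> 'n \<Rightarrow> real" where
  "dy r z j = frechet_derivative r (at z) (axis j \<i>)"

definition dz :: "(complex^'n \<Rightarrow> real) \<Rightarrow> complex^'n \<Rightarrow> 'n \<Rightarrow> complex" where
  "dz r z j = (complex_of_real (dx r z j) - \<i> * complex_of_real (dy r z j)) / 2"

definition del_pair :: "(complex^'n \<Rightarrow> real) \<Rightarrow> complex^'n \<Rightarrow> complex^'n \<Rightarrow> complex" where
  "del_pair r z X = (\<Sum>j\<in>UNIV. dz r z j * X $ j)"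

definition dzdzbar :: "(complex^'n \<Rightarrow> real) \<Rightarrow> complex^'n \<Rightarrow> 'n \<Rightarrow> 'n \<Rightarrow> complex" where
  "dzdzbar r z j k =
     (complex_of_real (dx (\<lambda>w. dx r w k) z j) + complex_of_real (dy (\<lambda>w. dy r w k) z j)
      + \<i> * (complex_of_real (dx (\<lambda>w. dy r w k) z j) - complex_of_real (dy (\<lambda>w. dx r w k) z j))) / 4"

definition levi_form :: "(complex^'n \<Rightarrow> real) \<Rightarrow> complex^'n \<Rightarrow> complex^'n \<Rightarrow> complex" where
  "levi_form r z X = (\<Sum>j\<in>UNIV. \<Sum>k\<in>UNIV. dzdzbar r z j k * X $ j * cnj (X $ k))"

definition defining_function :: "nat \<Rightarrow> (complex^'n \<Rightarrow> real) \<Rightarrow> (complex^'n) set \<Rightarrow> (complex^'n) set \<Rightarrow> bool" where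
  "defining_function k r U \<Omega> \<longleftrightarrow>
     open U \<and> closure \<Omega> \<subseteq> U \<and> Ck_on k r U \<and> \<Omega> = {z\<in>U. r z < 0} \<and>
     (\<forall>p\<in>frontier \<Omega>. frechet_derivative r (at p) \<noteq> (\<lambda>v. 0))"

definition pseudoconvex :: "(complex^'n) set \<Rightarrow> bool" where
  "pseudoconvex \<Omega> \<longleftrightarrow>
     (\<exists>r U. defining_function 2 r U \<Omega> \<and>
        (\<forall>p\<in>frontier \<Omega>. \<forall>X. del_pair r p X = 0 \<longrightarrow> 0 \<le> Re (levi_form r p X)))"

definition kobayashi :: "(complex^'n) set \<Rightarrow> complex^'n \<Rightarrow> complex^'n \<Rightarrow> real" where
  "kobayashi \<Omega> z X = Inf {1 / l | l. l > 0 \<and>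
     (\<exists>f :: complex \<Rightarrow> complex^'n.
        (\<forall>j. (\<lambda>w. f w $ j) holomorphic_on ball 0 1) \<and> f ` ball 0 1 \<subseteq> \<Omega> \<and> f 0 = z \<and>
        (\<forall>j. deriv (\<lambda>w. f w $ j) 0 = complex_of_real l * X $ j))}"

end

theory Submission
  imports Defs "HOL-Complex_Analysis.Cauchy_Integral_Formula"
begin

text \<open>
  Both parts rest on expanding \<open>r\<close> to second order along analytic discs
  \<open>\<zeta> \<mapsto> p + \<zeta> X + \<zeta>\<^sup>2 Y + \<dots>\<close>: the second-order part splits into the Levi form times
  \<open>|\<zeta>|\<^sup>2\<close> and a harmonic term \<open>Re (q \<zeta>\<^sup>2)\<close>.

  For (1), suppose the Levi form is negative at \<open>p\<close> in a complex tangential direction \<open>X\<close>.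
  Choosing \<open>Y\<close> to cancel the harmonic term, the discs
  \<open>\<zeta> \<mapsto> p - t N + \<zeta> (X + \<kappa> \<surd>t N) + \<zeta>\<^sup>2 Y\<close> with \<open>N\<close> transversal to the boundary
  lie in \<open>\<Omega>\<close> for \<open>|\<zeta>| < \<rho>\<close> with \<open>\<rho>\<close> independent of \<open>t\<close>, because
  \<open>\<kappa> \<surd>t |\<zeta>|\<close> is absorbed by \<open>t\<close> and the negative multiple of \<open>|\<zeta>|\<^sup>2\<close>. So the metric
  stays bounded while the normal component is of size \<open>\<surd>t\<close>, which is incompatible with \<open>\<alpha> > 1/2\<close>.

  For (2), let \<open>f\<close> be a disc in \<open>\<Omega>\<close> centred at \<open>z\<close> with \<open>f'(0) = W\<close>, put \<open>A = |\<langle>\<partial>r(z), W\<rangle>|\<close> and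
  rotate so that the pairing is real and positive. Adding the inequalities \<open>r (f \<rho>) < 0\<close>
  and \<open>r (f (i \<rho>)) < 0\<close> cancels all terms in \<open>\<zeta>\<^sup>2\<close> and leaves
  \<open>\<rho> A + L \<rho>\<^sup>2 \<le> |r(z)| + O(\<rho>\<^sup>3)\<close> with \<open>L\<close> the Levi form. As \<open>r\<close> is of class \<open>C\<^sup>3\<close>, comparison with a
  boundary point at distance \<open>O(|r(z)|)\<close> gives \<open>L \<ge> - O(|r(z)| + A)\<close>, and \<open>\<rho> = c |r(z)|\<^sup>1\<^sup>/\<^sup>3\<close>
  yields \<open>A = O(|r(z)|\<^sup>2\<^sup>/\<^sup>3)\<close>.
\<close>

section \<open>Taylor expansion of functions of class C2 and C3\<close>

text \<open>Iterated derivatives are taken in one fixed direction at a time, as in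
  \<open>Ck_on\<close>, so that each order is again a real-valued function of the point.\<close>

definition dd :: "('a::euclidean_space \<Rightarrow> real) \<Rightarrow> 'a \<Rightarrow> 'a \<Rightarrow> real" where
  "dd f x v = frechet_derivative f (at x) v"

definition dd2 :: "('a::euclidean_space \<Rightarrow> real) \<Rightarrow> 'a \<Rightarrow> 'a \<Rightarrow> 'a \<Rightarrow> real" where
  "dd2 f x v w = dd (\<lambda>y. dd f y v) x w"

definition dd3 :: "('a::euclidean_space \<Rightarrow> real) \<Rightarrow> 'a \<Rightarrow> 'a \<Rightarrow> 'a \<Rightarrow> 'a \<Rightarrow> real" where
  "dd3 f x u v w = dd (\<lambda>y. dd2 f y u v) x w"

lemma dd_eqI: "(f has_derivative f') (at x) \<Longrightarrow> dd f x = f'"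
  unfolding dd_def using frechet_derivative_at by fastforce

lemma has_derivative_dd: "(f has_derivative f') (at x) \<Longrightarrow> (f has_derivative dd f x) (at x)"
  using dd_eqI by metis

text \<open>Serves to differentiate identities that are known only at points of an open set, such as
  the linearity of \<open>dd r y\<close> for \<open>y\<close> in \<open>U\<close>.\<close>

lemma dd_cong_open:
  assumes "open U" "x \<in> U" "\<And>y. y \<in> U \<Longrightarrow> f y = g y" "(f has_derivative f') (at x)"
  shows "dd g x = f'"
  by (rule dd_eqI) (rule has_derivative_transform_within_open[OF assms(4,1,2,3)])

lemma Ck_on_cong:
  assumes "open U" "Ck_on k f U" "\<And>y. y \<in> U \<Longrightarrow> f y = g y"
  shows "Ck_on k g U"
  using assms(2,3)
proof (induction k arbitrary: f g)
  case 0
  then show ?case using continuous_on_cong[of U U f g] by simp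
next
  case (Suc k)
  from Suc.prems(1) obtain f' where f': "\<And>x. x \<in> U \<Longrightarrow> (f has_derivative f' x) (at x)" "\<And>v. Ck_on k (\<lambda>x. f' x v) U"
    unfolding Ck_on.simps by blast
  have "(g has_derivative f' x) (at x)" if "x \<in> U" for x
    by (rule has_derivative_transform_within_open[OF f'(1)[OF that] assms(1) that Suc.prems(2)])
  with f'(2) show ?case by auto
qed

text \<open>\<open>Ck_on\<close> only asserts that some derivative exists. Uniqueness of the Frechet
  derivative lets \<open>dd\<close> replace that witness at every point of \<open>U\<close>.\<close>

lemma Ck_on_SucD:
  assumes "open U" "Ck_on (Suc k) f U"
  shows "\<And>x. x \<in> U \<Longrightarrow> (f has_derivative dd f x) (at x)"
    and "\<And>v. Ck_on k (\<lambda>x. dd f x v) U"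
proof -
  obtain f' where f': "\<And>x. x \<in> U \<Longrightarrow> (f has_derivative f' x) (at x)" "\<And>v. Ck_on k (\<lambda>x. f' x v) U"
    using assms(2) by auto
  show *: "(f has_derivative dd f x) (at x)" if "x \<in> U" for x
    using has_derivative_dd f'(1)[OF that] by blast
  show "Ck_on k (\<lambda>x. dd f x v) U" for v
    by (rule Ck_on_cong[OF assms(1) f'(2)[of v]]) (simp add: dd_eqI[OF f'(1)])
qed

lemma Ck_on_Suc_continuous:
  assumes "Ck_on (Suc k) f U"
  shows "continuous_on U f"
proof -
  obtain f' where "\<And>x. x \<in> U \<Longrightarrow> (f has_derivative f' x) (at x)"
    using assms by auto
  then show ?thesis
    by (meson has_derivative_at_withinI has_derivative_continuous_on)
qed

lemma Ck_on_mono_Suc: "Ck_on (Suc k) f U \<Longrightarrow> Ck_on k f U"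
proof (induction k arbitrary: f)
  case 0
  then show ?case using Ck_on_Suc_continuous[of 0 f U] by (simp only: Ck_on.simps(1))
next
  case (Suc k)
  then show ?case by (metis Ck_on.simps(2))
qed

section \<open>Coordinate bounds for linear, bilinear and trilinear forms\<close>

lemma linear_expand_basis:
  fixes T :: "'a::euclidean_space \<Rightarrow> real"
  assumes "linear T"
  shows "T v = (\<Sum>b\<in>Basis. (v \<bullet> b) * T b)"
proof -
  have "T v = T (\<Sum>b\<in>Basis. (v \<bullet> b) *\<^sub>R b)"
    by (simp add: euclidean_representation)
  also have "\<dots> = (\<Sum>b\<in>Basis. (v \<bullet> b) * T b)"
    using assms by (simp add: linear_sum linear_scale)
  finally show ?thesis .
qed

lemma linear_bound_basis:
  fixes T :: "'a::euclidean_space \<Rightarrow> real"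
  assumes "linear T"
  shows "\<bar>T v\<bar> \<le> (\<Sum>b\<in>Basis. \<bar>T b\<bar>) * norm v"
proof -
  have "\<bar>T v\<bar> = \<bar>\<Sum>b\<in>Basis. (v \<bullet> b) * T b\<bar>" using linear_expand_basis[OF assms] by metis
  also have "\<dots> \<le> (\<Sum>b\<in>Basis. \<bar>(v \<bullet> b) * T b\<bar>)" by (rule sum_abs)
  also have "\<dots> \<le> (\<Sum>b\<in>Basis. norm v * \<bar>T b\<bar>)"
    by (intro sum_mono) (auto simp: abs_mult intro!: mult_right_mono Basis_le_norm)
  finally show ?thesis by (simp add: sum_distrib_left mult.commute)
qed

lemma bilinear_bound_basis:
  fixes T :: "'a::euclidean_space \<Rightarrow> 'a \<Rightarrow> real"
  assumes "\<And>w. linear (\<lambda>v. T v w)" "\<And>v. linear (T v)"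
  shows "\<bar>T v w\<bar> \<le> (\<Sum>b\<in>Basis. \<Sum>c\<in>Basis. \<bar>T b c\<bar>) * norm v * norm w"
proof -
  have "\<bar>T v w\<bar> \<le> (\<Sum>b\<in>Basis. \<bar>T b w\<bar>) * norm v"
    using linear_bound_basis[OF assms(1)] .
  also have "(\<Sum>b\<in>Basis. \<bar>T b w\<bar>) \<le> (\<Sum>b\<in>Basis. (\<Sum>c\<in>Basis. \<bar>T b c\<bar>) * norm w)"
    by (intro sum_mono linear_bound_basis assms(2))
  finally show ?thesis
    by (simp add: sum_distrib_right sum_distrib_left mult_right_mono mult_ac)
qed

lemma trilinear_bound_basis:
  fixes T :: "'a::euclidean_space \<Rightarrow> 'a \<Rightarrow> 'a \<Rightarrow> real"
  assumes "\<And>v w. linear (\<lambda>u. T u v w)" "\<And>u w. linear (\<lambda>v. T u v w)" "\<And>u v. linear (T u v)"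
  shows "\<bar>T u v w\<bar> \<le> (\<Sum>a\<in>Basis. \<Sum>b\<in>Basis. \<Sum>c\<in>Basis. \<bar>T a b c\<bar>) * norm u * norm v * norm w"
proof -
  have "\<bar>T u v w\<bar> \<le> (\<Sum>b\<in>Basis. \<bar>T b v w\<bar>) * norm u"
    using linear_bound_basis[OF assms(1)] .
  also have "(\<Sum>b\<in>Basis. \<bar>T b v w\<bar>) \<le> (\<Sum>a\<in>Basis. (\<Sum>b\<in>Basis. \<Sum>c\<in>Basis. \<bar>T a b c\<bar>) * norm v * norm w)"
    by (intro sum_mono bilinear_bound_basis assms)
  also have "\<dots> = (\<Sum>a\<in>Basis. \<Sum>b\<in>Basis. \<Sum>c\<in>Basis. \<bar>T a b c\<bar>) * norm v * norm w"
    by (simp only: sum_distrib_right)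
  finally show ?thesis
    by (simp add: mult_right_mono mult_ac)
qed

locale C2_function =
  fixes r :: "'a::euclidean_space \<Rightarrow> real" and U :: "'a set"
  assumes open_U: "open U" and C2: "Ck_on 2 r U"
begin

lemma Ck2: "Ck_on (Suc (Suc 0)) r U"
  using C2 by (simp only: numeral_2_eq_2)

lemma dd_at: "x \<in> U \<Longrightarrow> (r has_derivative dd r x) (at x)"
  using Ck_on_SucD[OF open_U Ck2] by blast

lemma Ck1_dd: "Ck_on (Suc 0) (\<lambda>x. dd r x v) U"
  using Ck_on_SucD[OF open_U Ck2] by blast

lemma dd2_at: "x \<in> U \<Longrightarrow> ((\<lambda>y. dd r y v) has_derivative dd2 r x v) (at x)"
  using Ck_on_SucD(1)[OF open_U Ck1_dd] unfolding dd2_def by (metis (no_types, lifting) ext)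

lemma continuous_r: "continuous_on U r"
  using Ck_on_Suc_continuous Ck2 by blast

lemma continuous_dd: "continuous_on U (\<lambda>x. dd r x v)"
  using Ck_on_Suc_continuous Ck1_dd by blast

lemma continuous_dd2: "continuous_on U (\<lambda>x. dd2 r x v w)"
  using Ck_on_SucD(2)[OF open_U Ck1_dd] unfolding dd2_def by simp

lemma linear_dd: "x \<in> U \<Longrightarrow> linear (dd r x)"
  using dd_at has_derivative_linear by blast

lemma linear_dd2: "x \<in> U \<Longrightarrow> linear (dd2 r x v)"
  using dd2_at has_derivative_linear by blast

text \<open>Linearity in the last direction comes with being a derivative. In the first direction it
  arises by differentiating the linearity of \<open>dd r y\<close> with respect to
  \<open>y\<close>.\<close>

lemma linear_dd2_left:
  assumes "x \<in> U" shows "linear (\<lambda>v. dd2 r x v w)"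
proof
  fix v v' :: 'a and a :: real
  have "dd (\<lambda>y. dd r y (v + v')) x = (\<lambda>w. dd2 r x v w + dd2 r x v' w)"
    by (rule dd_cong_open[OF open_U assms])
       (auto simp: linear_add[OF linear_dd] intro!: has_derivative_add dd2_at assms)
  then show "dd2 r x (v + v') w = dd2 r x v w + dd2 r x v' w"
    unfolding dd2_def[of r x "v + v'"] by simp
  have "dd (\<lambda>y. dd r y (a *\<^sub>R v)) x = (\<lambda>w. a * dd2 r x v w)"
    by (rule dd_cong_open[OF open_U assms])
       (auto simp: linear_scale[OF linear_dd] intro!: has_derivative_mult_right dd2_at assms)
  then show "dd2 r x (a *\<^sub>R v) w = a *\<^sub>R dd2 r x v w"
    unfolding dd2_def[of r x "a *\<^sub>R v"] by simp
qed

lemma DERIV_line: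
  assumes "x + t *\<^sub>R h \<in> U"
  shows "((\<lambda>t. r (x + t *\<^sub>R h)) has_real_derivative dd r (x + t *\<^sub>R h) h) (at t)"
proof -
  have 1: "((\<lambda>t. x + t *\<^sub>R h) has_derivative (\<lambda>t. t *\<^sub>R h)) (at t)"
    by (auto intro!: derivative_eq_intros)
  have "((\<lambda>t. r (x + t *\<^sub>R h)) has_derivative (\<lambda>s. dd r (x + t *\<^sub>R h) (s *\<^sub>R h))) (at t)"
    by (rule has_derivative_compose[OF 1 dd_at[OF assms]])
  then show ?thesis
    using linear_scale[OF linear_dd[OF assms]] by (simp add: has_field_derivative_def mult_commute_abs)
qed

lemma DERIV_line_dd:
  assumes "x + t *\<^sub>R h \<in> U"
  shows "((\<lambda>t. dd r (x + t *\<^sub>R h) v) has_real_derivative dd2 r (x + t *\<^sub>R h) v h) (at t)"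
proof -
  have 1: "((\<lambda>t. x + t *\<^sub>R h) has_derivative (\<lambda>t. t *\<^sub>R h)) (at t)"
    by (auto intro!: derivative_eq_intros)
  have "((\<lambda>t. dd r (x + t *\<^sub>R h) v) has_derivative (\<lambda>s. dd2 r (x + t *\<^sub>R h) v (s *\<^sub>R h))) (at t)"
    by (rule has_derivative_compose[OF 1 dd2_at[OF assms]])
  then show ?thesis
    using linear_scale[OF linear_dd2[OF assms]] by (simp add: has_field_derivative_def mult_commute_abs)
qed

lemma Taylor2_line:
  assumes "\<And>t. 0 \<le> t \<Longrightarrow> t \<le> 1 \<Longrightarrow> x + t *\<^sub>R h \<in> U"
  shows "\<exists>t. 0 < t \<and> t \<le> 1 \<and> r (x + h) = r x + dd r x h + dd2 r (x + t *\<^sub>R h) h h / 2"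
proof -
  \<comment> \<open>\<open>df m\<close> is the derivative of order \<open>m\<close> of
    \<open>r\<close> along the segment. Maclaurin's formula with Lagrange remainder is evaluated at
    parameter 1.\<close>
  define df where "df = (\<lambda>m t. if m = 0 then r (x + t *\<^sub>R h) else if m = Suc 0 then dd r (x + t *\<^sub>R h) h
    else dd2 r (x + t *\<^sub>R h) h h)"
  have "\<exists>t. 0 < t \<and> t \<le> 1 \<and> r (x + 1 *\<^sub>R h) = (\<Sum>m<2. df m 0 / (fact m) * 1 ^ m) + df 2 t / fact 2 * 1 ^ 2"
  proof (rule Maclaurin2)
    show "\<forall>m t. m < 2 \<and> 0 \<le> t \<and> t \<le> 1 \<longrightarrow> DERIV (df m) t :> df (Suc m) t"
    proof (intro allI impI)
      fix m :: nat and t :: real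
      assume *: "m < 2 \<and> 0 \<le> t \<and> t \<le> 1"
      then have m: "m = 0 \<or> m = 1" by auto
      show "DERIV (df m) t :> df (Suc m) t"
        using m DERIV_line[OF assms] DERIV_line_dd[OF assms] * unfolding df_def by auto
    qed
  qed (auto simp: df_def)
  then show ?thesis by (simp add: df_def numeral_2_eq_2)
qed

lemma dd_lipschitz_line:
  assumes "\<And>t. 0 \<le> t \<Longrightarrow> t \<le> 1 \<Longrightarrow> x + t *\<^sub>R h \<in> U"
  shows "\<exists>t. 0 < t \<and> t < 1 \<and> dd r (x + h) v = dd r x v + dd2 r (x + t *\<^sub>R h) v h"
proof -
  have "\<exists>t. 0 < t \<and> t < 1 \<and> dd r (x + 1 *\<^sub>R h) v - dd r (x + 0 *\<^sub>R h) v = (1 - 0) * dd2 r (x + t *\<^sub>R h) v h"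
    using DERIV_line_dd[OF assms] by (intro MVT2) auto
  then show ?thesis by (simp add: diff_eq_eq add.commute)
qed

text \<open>A sum over basis vectors dominates the operator norm of the Hessian and is visibly
  continuous in \<open>x\<close>, hence bounded on compact subsets of \<open>U\<close>.\<close>

definition bnd2 where "bnd2 x = (\<Sum>b\<in>Basis. \<Sum>c\<in>Basis. \<bar>dd2 r x b c\<bar>)"

lemma dd2_bound: "x \<in> U \<Longrightarrow> \<bar>dd2 r x v w\<bar> \<le> bnd2 x * norm v * norm w"
  unfolding bnd2_def by (rule bilinear_bound_basis) (auto intro: linear_dd2 linear_dd2_left)

lemma bnd2_nonneg: "0 \<le> bnd2 x" unfolding bnd2_def by (intro sum_nonneg) auto

lemma continuous_bnd2: "continuous_on U bnd2"
  unfolding bnd2_def by (intro continuous_intros continuous_dd2)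

text \<open>The Lagrange remainder contains the Hessian at an intermediate point. Its coefficients
  are continuous at \<open>p\<close>, so moving that point to \<open>p\<close> costs at most
  \<open>e * norm h ^ 2\<close>.\<close>

lemma Taylor2_little_o:
  assumes "p \<in> U" "e > 0"
  shows "\<exists>d>0. \<forall>h. norm h < d \<longrightarrow> p + h \<in> U \<and>
     \<bar>r (p + h) - (r p + dd r p h + dd2 r p h h / 2)\<bar> \<le> e * norm h ^ 2"
proof -
  define g where "g x = (\<Sum>b\<in>Basis. \<Sum>c\<in>Basis. \<bar>dd2 r x b c - dd2 r p b c\<bar>)" for x
  have "continuous_on U g"
    unfolding g_def by (intro continuous_intros continuous_dd2)
  then have "isCont g p" using open_U assms(1) continuous_on_eq_continuous_at by blast
  moreover have "g p = 0" by (simp add: g_def)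
  ultimately have "\<exists>d>0. \<forall>x. dist x p < d \<longrightarrow> dist (g x) 0 < e"
    using assms(2) by (simp add: continuous_at_eps_delta dist_norm)
  then obtain d1 where d1: "d1 > 0" "\<And>x. dist x p < d1 \<Longrightarrow> g x < e"
    by fastforce
  obtain d2 where d2: "d2 > 0" "ball p d2 \<subseteq> U" using open_U assms(1) openE by blast
  have "p + h \<in> U \<and> \<bar>r (p + h) - (r p + dd r p h + dd2 r p h h / 2)\<bar> \<le> e * norm h ^ 2"
    if h: "norm h < min d1 d2" for h
  proof -
    have n: "norm (t *\<^sub>R h) \<le> norm h" if "0 \<le> t" "t \<le> 1" for t using that by (simp add: mult_left_le_one_le)
    have inU: "p + t *\<^sub>R h \<in> U" if "0 \<le> t" "t \<le> 1" for t
      using d2(2) n[OF that] h by (force simp: dist_norm)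
    obtain t where t: "0 < t" "t \<le> 1" "r (p + h) = r p + dd r p h + dd2 r (p + t *\<^sub>R h) h h / 2"
      using Taylor2_line[OF inU] by blast
    have tU: "p + t *\<^sub>R h \<in> U" using inU t by simp
    have "\<bar>dd2 r (p + t *\<^sub>R h) h h - dd2 r p h h\<bar> \<le> g (p + t *\<^sub>R h) * norm h * norm h"
      unfolding g_def
      by (rule bilinear_bound_basis)
         (auto intro!: linear_compose_sub linear_dd2 linear_dd2_left tU assms(1))
    also have "\<dots> \<le> e * norm h * norm h"
      using d1(2)[of "p + t *\<^sub>R h"] n[of t] t h by (intro mult_right_mono) (auto simp: dist_norm)
    finally have "\<bar>r (p + h) - (r p + dd r p h + dd2 r p h h / 2)\<bar> \<le> (e * norm h ^ 2) / 2"
      unfolding t(3) power2_eq_square by (simp add: abs_if field_simps split: if_splits)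
    also have "\<dots> \<le> e * norm h ^ 2" using assms(2) by simp
    finally show ?thesis using inU[of 1] by simp
  qed
  then show ?thesis using d1 d2 by (intro exI[of _ "min d1 d2"]) auto
qed

end

section \<open>Third-order calculus along segments\<close>

locale C3_function =
  fixes r :: "'a::euclidean_space \<Rightarrow> real" and U :: "'a set"
  assumes open_U3: "open U" and C3: "Ck_on 3 r U"

sublocale C3_function \<subseteq> C2_function r U
  using C3 Ck_on_mono_Suc[of 2 r U] by unfold_locales (auto simp: open_U3 numeral_3_eq_3 numeral_2_eq_2)

context C3_function begin

lemma Ck1_dd2: "Ck_on (Suc 0) (\<lambda>x. dd2 r x v w) U"
proof -
  have "Ck_on (Suc (Suc 0)) (\<lambda>x. dd r x v) U"
    using Ck_on_SucD(2)[OF open_U3 C3[unfolded numeral_3_eq_3]] .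
  from Ck_on_SucD(2)[OF open_U3 this] show ?thesis unfolding dd2_def .
qed

lemma dd3_at: "x \<in> U \<Longrightarrow> ((\<lambda>y. dd2 r y u v) has_derivative dd3 r x u v) (at x)"
  using Ck_on_SucD(1)[OF open_U3 Ck1_dd2] unfolding dd3_def by (metis (no_types, lifting) ext)

lemma continuous_dd3: "continuous_on U (\<lambda>x. dd3 r x u v w)"
  using Ck_on_SucD(2)[OF open_U3 Ck1_dd2] unfolding dd3_def by simp

lemma linear_dd3: "x \<in> U \<Longrightarrow> linear (dd3 r x u v)"
  using dd3_at has_derivative_linear by blast

lemma linear_dd3_middle:
  assumes "x \<in> U" shows "linear (\<lambda>v. dd3 r x u v w)"
proof
  fix v v' :: 'a and a :: real
  have "dd (\<lambda>y. dd2 r y u (v + v')) x = (\<lambda>w. dd3 r x u v w + dd3 r x u v' w)"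
    by (rule dd_cong_open[OF open_U assms])
       (auto simp: linear_add[OF linear_dd2] intro!: has_derivative_add dd3_at assms)
  then show "dd3 r x u (v + v') w = dd3 r x u v w + dd3 r x u v' w"
    unfolding dd3_def[of r x u "v + v'"] by simp
  have "dd (\<lambda>y. dd2 r y u (a *\<^sub>R v)) x = (\<lambda>w. a * dd3 r x u v w)"
    by (rule dd_cong_open[OF open_U assms])
       (auto simp: linear_scale[OF linear_dd2] intro!: has_derivative_mult_right dd3_at assms)
  then show "dd3 r x u (a *\<^sub>R v) w = a *\<^sub>R dd3 r x u v w"
    unfolding dd3_def[of r x u "a *\<^sub>R v"] by simp
qed

lemma linear_dd3_left:
  assumes "x \<in> U" shows "linear (\<lambda>u. dd3 r x u v w)"
proof
  fix u u' :: 'a and a :: real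
  have "dd (\<lambda>y. dd2 r y (u + u') v) x = (\<lambda>w. dd3 r x u v w + dd3 r x u' v w)"
    by (rule dd_cong_open[OF open_U assms])
       (auto simp: linear_add[OF linear_dd2_left] intro!: has_derivative_add dd3_at assms)
  then show "dd3 r x (u + u') v w = dd3 r x u v w + dd3 r x u' v w"
    unfolding dd3_def[of r x "u + u'"] by simp
  have "dd (\<lambda>y. dd2 r y (a *\<^sub>R u) v) x = (\<lambda>w. a * dd3 r x u v w)"
    by (rule dd_cong_open[OF open_U assms])
       (auto simp: linear_scale[OF linear_dd2_left] intro!: has_derivative_mult_right dd3_at assms)
  then show "dd3 r x (a *\<^sub>R u) v w = a *\<^sub>R dd3 r x u v w"
    unfolding dd3_def[of r x "a *\<^sub>R u"] by simp
qed

lemma DERIV_line_dd2: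
  assumes "x + t *\<^sub>R h \<in> U"
  shows "((\<lambda>t. dd2 r (x + t *\<^sub>R h) u v) has_real_derivative dd3 r (x + t *\<^sub>R h) u v h) (at t)"
proof -
  have 1: "((\<lambda>t. x + t *\<^sub>R h) has_derivative (\<lambda>t. t *\<^sub>R h)) (at t)"
    by (auto intro!: derivative_eq_intros)
  have "((\<lambda>t. dd2 r (x + t *\<^sub>R h) u v) has_derivative (\<lambda>s. dd3 r (x + t *\<^sub>R h) u v (s *\<^sub>R h))) (at t)"
    by (rule has_derivative_compose[OF 1 dd3_at[OF assms]])
  then show ?thesis
    using linear_scale[OF linear_dd3[OF assms]] by (simp add: has_field_derivative_def mult_commute_abs)
qed

lemma Taylor3_line:
  assumes "\<And>t. 0 \<le> t \<Longrightarrow> t \<le> 1 \<Longrightarrow> x + t *\<^sub>R h \<in> U"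
  shows "\<exists>t. 0 < t \<and> t \<le> 1 \<and>
    r (x + h) = r x + dd r x h + dd2 r x h h / 2 + dd3 r (x + t *\<^sub>R h) h h h / 6"
proof -
  define df where "df = (\<lambda>m t. if m = 0 then r (x + t *\<^sub>R h) else if m = Suc 0 then dd r (x + t *\<^sub>R h) h
    else if m = Suc (Suc 0) then dd2 r (x + t *\<^sub>R h) h h else dd3 r (x + t *\<^sub>R h) h h h)"
  have "\<exists>t. 0 < t \<and> t \<le> 1 \<and> r (x + 1 *\<^sub>R h) = (\<Sum>m<3. df m 0 / (fact m) * 1 ^ m) + df 3 t / fact 3 * 1 ^ 3"
  proof (rule Maclaurin2)
    show "\<forall>m t. m < 3 \<and> 0 \<le> t \<and> t \<le> 1 \<longrightarrow> DERIV (df m) t :> df (Suc m) t"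
    proof (intro allI impI)
      fix m :: nat and t :: real
      assume *: "m < 3 \<and> 0 \<le> t \<and> t \<le> 1"
      then have m: "m = 0 \<or> m = Suc 0 \<or> m = Suc (Suc 0)" by auto
      show "DERIV (df m) t :> df (Suc m) t"
        using m DERIV_line[OF assms] DERIV_line_dd[OF assms] DERIV_line_dd2[OF assms] * unfolding df_def by auto
    qed
  qed (auto simp: df_def)
  then show ?thesis by (simp add: df_def numeral_3_eq_3 fact_numeral)
qed

lemma dd2_lipschitz_line:
  assumes "\<And>t. 0 \<le> t \<Longrightarrow> t \<le> 1 \<Longrightarrow> x + t *\<^sub>R h \<in> U"
  shows "\<exists>t. 0 < t \<and> t < 1 \<and> dd2 r (x + h) u v = dd2 r x u v + dd3 r (x + t *\<^sub>R h) u v h"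
proof -
  have "\<exists>t. 0 < t \<and> t < 1 \<and> dd2 r (x + 1 *\<^sub>R h) u v - dd2 r (x + 0 *\<^sub>R h) u v = (1 - 0) * dd3 r (x + t *\<^sub>R h) u v h"
    using DERIV_line_dd2[OF assms] by (intro MVT2) auto
  then show ?thesis by (simp add: diff_eq_eq add.commute)
qed

definition bnd3 where "bnd3 x = (\<Sum>a\<in>Basis. \<Sum>b\<in>Basis. \<Sum>c\<in>Basis. \<bar>dd3 r x a b c\<bar>)"

lemma dd3_bound: "x \<in> U \<Longrightarrow> \<bar>dd3 r x u v w\<bar> \<le> bnd3 x * norm u * norm v * norm w"
  unfolding bnd3_def
  by (rule trilinear_bound_basis) (auto intro: linear_dd3 linear_dd3_left linear_dd3_middle)

lemma continuous_bnd3: "continuous_on U bnd3"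
  unfolding bnd3_def by (intro continuous_intros continuous_dd3)

end

section \<open>Complex directions and the Levi form\<close>

text \<open>Allows the real multilinear derivatives to be evaluated on complex multiples of a
  vector.\<close>

lemma cscale_decomp: "c *s X = Re c *\<^sub>R X + Im c *\<^sub>R (\<i> *s X)"
  for X :: "complex^'n"
  by (simp add: vec_eq_iff complex_eq_iff)

lemma norm_cscale: "norm (c *s X) = cmod c * norm X"
  for X :: "complex^'n"
  by (simp add: norm_vec_def norm_mult L2_set_right_distrib)

lemma cvec_expand: "X = (\<Sum>j\<in>UNIV. Re (X $ j) *\<^sub>R axis j 1 + Im (X $ j) *\<^sub>R axis j \<i>)"
  for X :: "complex^'n"
proof -
  have "(\<Sum>j\<in>UNIV. Re (X $ j) *\<^sub>R axis j 1 + Im (X $ j) *\<^sub>R axis j \<i>) $ i = X $ i" for i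
  proof -
    have "(\<Sum>j\<in>UNIV. Re (X $ j) *\<^sub>R axis j 1 + Im (X $ j) *\<^sub>R axis j \<i>) $ i
       = (\<Sum>j\<in>UNIV. if j = i then X $ i else 0)"
      unfolding sum_component
      by (rule sum.cong) (auto simp: axis_def complex_eq_iff)
    then show ?thesis by simp
  qed
  then show ?thesis by (simp add: vec_eq_iff)
qed

lemma linear_cvec_expand:
  fixes T :: "complex^'n \<Rightarrow> real"
  assumes "linear T"
  shows "T X = (\<Sum>j\<in>UNIV. Re (X $ j) * T (axis j 1) + Im (X $ j) * T (axis j \<i>))"
  by (subst cvec_expand[of X]) (simp add: linear_sum[OF assms] linear_add[OF assms] linear_scale[OF assms])

lemma bilinear_cvec_expand:
  fixes T :: "complex^'n \<Rightarrow> complex^'n \<Rightarrow> real"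
  assumes "\<And>w. linear (\<lambda>v. T v w)" "\<And>v. linear (T v)"
  shows "T X Y = (\<Sum>j\<in>UNIV. \<Sum>k\<in>UNIV.
      Re (X $ k) * (Re (Y $ j) * T (axis k 1) (axis j 1) + Im (Y $ j) * T (axis k 1) (axis j \<i>))
    + Im (X $ k) * (Re (Y $ j) * T (axis k \<i>) (axis j 1) + Im (Y $ j) * T (axis k \<i>) (axis j \<i>)))"
  apply (subst linear_cvec_expand[OF assms(2)])
  apply (subst linear_cvec_expand[OF assms(1), where X=X])
  apply (subst linear_cvec_expand[OF assms(1), where X=X])
  apply (rule sum.cong[OF refl])
  apply (simp add: sum_distrib_left sum.distrib algebra_simps)
  done

lemma del_pair_scale: "del_pair r z (c *s X) = c * del_pair r z X"
  by (simp add: del_pair_def sum_distrib_left mult_ac)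

lemma del_pair_add: "del_pair r z (X + Y) = del_pair r z X + del_pair r z Y"
  by (simp add: del_pair_def sum.distrib algebra_simps)

lemma dx_dd: "dx r z j = dd r z (axis j 1)" and dy_dd: "dy r z j = dd r z (axis j \<i>)"
  by (simp_all add: dx_def dy_def dd_def)

text \<open>As \<open>r\<close> is real-valued, the (0,1)-part of its differential is the conjugate
  of the (1,0)-part \<open>del_pair\<close>.\<close>

lemma dd_del_pair:
  assumes "linear (dd r z)"
  shows "dd r z X = 2 * Re (del_pair r z X)"
  by (subst linear_cvec_expand[OF assms])
     (auto simp: del_pair_def dz_def dx_dd dy_dd sum_distrib_left field_simps intro!: sum.cong)

text \<open>Complex linearity of \<open>del_pair\<close> recovers its imaginary part from the real
  differential in the direction \<open>\<i> *s X\<close>.\<close>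

lemma norm_del_pair_le:
  assumes "linear (dd r z)" "\<And>v. \<bar>dd r z v\<bar> \<le> M * norm v"
  shows "cmod (del_pair r z X) \<le> M * norm X"
proof -
  have "2 * Re (del_pair r z X) = dd r z X" using dd_del_pair[OF assms(1)] by simp
  moreover have "2 * Im (del_pair r z X) = - dd r z (\<i> *s X)"
    using dd_del_pair[OF assms(1), of "\<i> *s X"] by (simp add: del_pair_scale)
  moreover have "norm (\<i> *s X) = norm X" by (simp add: norm_cscale)
  ultimately have "\<bar>Re (del_pair r z X)\<bar> \<le> M * norm X / 2" "\<bar>Im (del_pair r z X)\<bar> \<le> M * norm X / 2"
    using assms(2)[of X] assms(2)[of "\<i> *s X"] by auto
  then show ?thesis using cmod_le[of "del_pair r z X"] by linarith
qed

text \<open>The contribution of one index pair to the Levi form, with \<open>a\<close> and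
  \<open>b\<close> the two components of \<open>X\<close> and \<open>P\<close>, \<open>Q\<close>,
  \<open>R\<close>, \<open>S\<close> the second derivatives in the four pairs of real coordinate
  directions. The first bracket belongs to the Hessian at \<open>X\<close>, the second to the
  Hessian at \<open>\<i> *s X\<close>.\<close>

definition levi_term :: "complex \<Rightarrow> complex \<Rightarrow> real \<Rightarrow> real \<Rightarrow> real \<Rightarrow> real \<Rightarrow> real" where
  "levi_term a b P Q R S =
    ((Re b * (Re a * P + Im a * Q) + Im b * (Re a * R + Im a * S))
    + (Im b * (Im a * P - Re a * Q) + Re b * (Re a * S - Im a * R))) / 4"

lemma levi_term:
  "Re ((complex_of_real P + complex_of_real S + \<i> * (complex_of_real R - complex_of_real Q)) / 4 * a * cnj b)
    = levi_term a b P Q R S"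
  by (simp add: levi_term_def field_simps)

text \<open>Both sides are expanded over the real coordinate directions and agree for each pair of
  indices. Every later estimate of the Levi form is thereby reduced to the real Hessian.\<close>

lemma levi_form_dd2:
  fixes r :: "complex^'n \<Rightarrow> real"
  assumes "C2_function r U" "z \<in> U"
  shows "Re (levi_form r z X) = (dd2 r z X X + dd2 r z (\<i> *s X) (\<i> *s X)) / 4"
proof -
  interpret C2_function r U by fact
  have bl: "\<And>w. linear (\<lambda>v. dd2 r z v w)" "\<And>v. linear (dd2 r z v)"
    using linear_dd2 linear_dd2_left assms(2) by auto
  have t: "Re (dzdzbar r z j k * X $ j * cnj (X $ k)) =
     levi_term (X $ j) (X $ k) (dd2 r z (axis k 1) (axis j 1)) (dd2 r z (axis k 1) (axis j \<i>))
       (dd2 r z (axis k \<i>) (axis j 1)) (dd2 r z (axis k \<i>) (axis j \<i>))" for j k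
    unfolding dzdzbar_def dx_dd dy_dd dd2_def by (rule levi_term)
  show ?thesis
    unfolding levi_form_def Re_sum t levi_term_def
      bilinear_cvec_expand[OF bl, of X X] bilinear_cvec_expand[OF bl, of "\<i> *s X" "\<i> *s X"]
    by (simp add: sum_divide_distrib[symmetric] sum.distrib[symmetric] add_divide_distrib algebra_simps)
qed

text \<open>The coefficient of the harmonic part of the second-order expansion in \<open>dd2_cscale\<close>.\<close>

definition hol_hess :: "(complex^'n \<Rightarrow> real) \<Rightarrow> complex^'n \<Rightarrow> complex^'n \<Rightarrow> complex" where
  "hol_hess r z X = Complex ((dd2 r z X X - dd2 r z (\<i> *s X) (\<i> *s X)) / 4)
     (- (dd2 r z X (\<i> *s X) + dd2 r z (\<i> *s X) X) / 4)"

text \<open>By bilinearity the left side is a real quadratic form in \<open>Re c\<close> and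
  \<open>Im c\<close>. Its rotation-invariant part is the Levi form by \<open>levi_form_dd2\<close>,
  and the rest is the real part of a multiple of \<open>c\<^sup>2\<close>.\<close>

lemma dd2_cscale:
  fixes r :: "complex^'n \<Rightarrow> real"
  assumes "C2_function r U" "z \<in> U"
  shows "dd2 r z (c *s X) (c *s X) / 2
    = Re (levi_form r z X) * (cmod c)\<^sup>2 + Re (hol_hess r z X * c\<^sup>2)"
proof -
  interpret C2_function r U by fact
  note l = linear_dd2[OF assms(2)] linear_dd2_left[OF assms(2)]
  show ?thesis
    unfolding cscale_decomp[of c X] levi_form_dd2[OF assms]
    by (simp add: linear_add[OF l(1)] linear_add[OF l(2)] linear_scale[OF l(1)] linear_scale[OF l(2)]
        hol_hess_def cmod_def power2_eq_square field_simps)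
qed

lemma ex_del_pair_eq_1:
  assumes "linear (dd r z)" "dd r z v \<noteq> 0"
  shows "\<exists>N. del_pair r z N = 1"
proof -
  have "del_pair r z v \<noteq> 0" using dd_del_pair[OF assms(1), of v] assms(2) by auto
  then show ?thesis
    by (intro exI[of _ "inverse (del_pair r z v) *s v"]) (simp add: del_pair_scale)
qed

text \<open>The perturbation \<open>k\<close> is kept exactly in the linear term, while its effect
  on the quadratic term is of order \<sigma>^3. The scale \<sigma> is separate from |\<zeta>|
  because \<open>k\<close> need not vanish at the centre of the disc.\<close>

lemma disc_expansion:
  fixes r :: "complex^'n \<Rightarrow> real"
  assumes "C2_function r U" "p \<in> U" "0 \<le> K" "0 < e"
  shows "\<exists>d>0. \<forall>\<zeta> k \<sigma>. cmod \<zeta> \<le> \<sigma> \<and> \<sigma> < d \<and> norm k \<le> K * \<sigma>\<^sup>2 \<longrightarrow>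
     p + (\<zeta> *s X + k) \<in> U \<and>
     \<bar>r (p + (\<zeta> *s X + k)) - (r p + dd r p (\<zeta> *s X + k)
        + Re (levi_form r p X) * (cmod \<zeta>)\<^sup>2 + Re (hol_hess r p X * \<zeta>\<^sup>2))\<bar> \<le> e * \<sigma>\<^sup>2"
proof -
  interpret C2_function r U by fact
  note l = linear_dd2[OF assms(2)] linear_dd2_left[OF assms(2)]
  define a where "a = norm X + K"
  define A where "A = bnd2 p * (2 * norm X * K + K\<^sup>2)"
  have a0: "0 \<le> a" using assms(3) by (simp add: a_def)
  have A0: "0 \<le> A" unfolding A_def using bnd2_nonneg assms(3) by (intro mult_nonneg_nonneg add_nonneg_nonneg) auto
  \<comment> \<open>Half of the error \<open>e\<close> is reserved for the Taylor remainder, the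
    other half for the cross terms containing \<open>k\<close>.\<close>
  define e' where "e' = e / (2 * (a\<^sup>2 + 1))"
  have a2: "a\<^sup>2 + 1 > 0" by (smt (verit) zero_le_power2)
  have e': "e' > 0" using assms(4) a2 by (simp add: e'_def)
  have e'a: "e' * a\<^sup>2 \<le> e / 2"
    unfolding e'_def using assms(4) a2 by (simp add: field_simps)
  obtain d0 where d0: "d0 > 0" "\<And>h. norm h < d0 \<Longrightarrow> p + h \<in> U \<and>
     \<bar>r (p + h) - (r p + dd r p h + dd2 r p h h / 2)\<bar> \<le> e' * norm h ^ 2"
    using Taylor2_little_o[OF assms(2) e'] by blast
  \<comment> \<open>The three entries ensure that \<sigma> is at most 1, that the displacement stays
    below \<open>d0\<close>, and that the cross terms, at most \<open>A * \<sigma>\<close> times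
    \<sigma>^2, fit into their share of the error.\<close>
  define d where "d = Min {1, d0 / (a + 1), e / (2 * (A + 1))}"
  have d: "d > 0" "d \<le> 1" "d \<le> d0 / (a + 1)" "d \<le> e / (2 * (A + 1))"
    unfolding d_def using d0 assms(4) a0 A0 by auto
  have main: "p + (\<zeta> *s X + k) \<in> U \<and>
     \<bar>r (p + (\<zeta> *s X + k)) - (r p + dd r p (\<zeta> *s X + k)
        + Re (levi_form r p X) * (cmod \<zeta>)\<^sup>2 + Re (hol_hess r p X * \<zeta>\<^sup>2))\<bar> \<le> e * \<sigma>\<^sup>2"
    if H: "cmod \<zeta> \<le> \<sigma>" "\<sigma> < d" "norm k \<le> K * \<sigma>\<^sup>2" for \<zeta> k \<sigma>
  proof -
    let ?x = "\<zeta> *s X" let ?h = "\<zeta> *s X + k"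
    have s0: "0 \<le> \<sigma>" using H(1) norm_ge_zero order_trans by blast
    have s1: "\<sigma> \<le> 1" using H(2) d by simp
    have s2: "\<sigma>\<^sup>2 \<le> \<sigma>" using s0 s1 by (simp add: power2_eq_square mult_left_le)
    have nx: "norm ?x \<le> norm X * \<sigma>"
      using H(1) by (simp add: norm_cscale mult.commute[of "norm X"] mult_right_mono)
    have "norm k \<le> K * \<sigma>" using H(3) s2 assms(3) by (meson mult_left_mono order_trans)
    then have nh: "norm ?h \<le> a * \<sigma>"
      using nx norm_triangle_ineq[of ?x k] by (simp add: a_def algebra_simps)
    also have "a * \<sigma> \<le> a * d" using H(2) a0 by (intro mult_left_mono) auto
    also have "\<dots> < (a + 1) * d" using d by simp
    also have "\<dots> \<le> d0" using d(3) a0 by (simp add: field_simps)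
    finally have 1: "p + ?h \<in> U" "\<bar>r (p + ?h) - (r p + dd r p ?h + dd2 r p ?h ?h / 2)\<bar> \<le> e' * (norm ?h)\<^sup>2"
      using d0(2) by auto
    have "e' * (norm ?h)\<^sup>2 \<le> e' * (a * \<sigma>)\<^sup>2"
      using nh e' by (intro mult_left_mono power_mono) auto
    also have "\<dots> = (e' * a\<^sup>2) * \<sigma>\<^sup>2" by (simp add: power_mult_distrib)
    also have "\<dots> \<le> e / 2 * \<sigma>\<^sup>2" using e'a by (intro mult_right_mono) auto
    finally have 2: "e' * (norm ?h)\<^sup>2 \<le> e / 2 * \<sigma>\<^sup>2" .
    have "dd2 r p ?h ?h - dd2 r p ?x ?x = dd2 r p ?x k + dd2 r p k ?x + dd2 r p k k"
      by (simp add: linear_add[OF l(1)] linear_add[OF l(2)])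
    also have "\<bar>\<dots>\<bar> \<le> bnd2 p * norm ?x * norm k + bnd2 p * norm k * norm ?x + bnd2 p * norm k * norm k"
      using dd2_bound[OF assms(2), of ?x k] dd2_bound[OF assms(2), of k ?x] dd2_bound[OF assms(2), of k k] by linarith
    also have "\<dots> = bnd2 p * (2 * (norm ?x * norm k) + norm k * norm k)" by (simp add: algebra_simps)
    also have "\<dots> \<le> bnd2 p * (2 * ((norm X * \<sigma>) * (K * \<sigma>\<^sup>2)) + (K * \<sigma>\<^sup>2) * (K * \<sigma>\<^sup>2))"
      using nx H(3) bnd2_nonneg s0 assms(3) by (intro mult_left_mono add_mono mult_mono) auto
    also have "\<dots> = bnd2 p * (2 * norm X * K + K\<^sup>2 * \<sigma>) * (\<sigma> * \<sigma>\<^sup>2)"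
      by (simp add: power2_eq_square algebra_simps)
    also have "\<dots> \<le> A * (\<sigma> * \<sigma>\<^sup>2)"
      unfolding A_def using s0 s1 bnd2_nonneg
      by (intro mult_right_mono mult_left_mono add_left_mono) (auto simp: mult_left_le)
    also have "\<dots> = (A * \<sigma>) * \<sigma>\<^sup>2" by simp
    also have "\<dots> \<le> e / 2 * \<sigma>\<^sup>2"
    proof (intro mult_right_mono)
      have "A * \<sigma> \<le> (A + 1) * d" using A0 s0 H(2) by (intro mult_mono) auto
      also have "\<dots> \<le> e / 2" using d(4) A0 by (simp add: field_simps)
      finally show "A * \<sigma> \<le> e / 2" .
    qed auto
    finally have 3: "\<bar>dd2 r p ?h ?h - dd2 r p ?x ?x\<bar> \<le> e / 2 * \<sigma>\<^sup>2" .
    show ?thesis using 1 2 3 dd2_cscale[OF assms(1,2), of \<zeta> X] by argo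
  qed
  show ?thesis using d(1) main by blast
qed

section \<open>Pseudoconvexity from the lower bound\<close>

locale C2_domain = C2_function r U for r :: "complex^'n \<Rightarrow> real" and U +
  fixes \<Omega> :: "(complex^'n) set"
  assumes closure_subset_U: "closure \<Omega> \<subseteq> U" and Omega_eq: "\<Omega> = {z\<in>U. r z < 0}"
    and dd_nonzero: "\<And>p. p \<in> frontier \<Omega> \<Longrightarrow> \<exists>v. dd r p v \<noteq> 0"

lemma C2_domain_iff: "defining_function 2 r U \<Omega> \<longleftrightarrow> C2_domain r U \<Omega>"
  by (auto simp: defining_function_def C2_domain_def C2_domain_axioms_def C2_function_def dd_def fun_eq_iff)

context C2_domain begin

lemma open_Omega: "open \<Omega>"
proof -
  have "\<Omega> = U \<inter> r -` {..<0}" using Omega_eq by auto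
  then show ?thesis using continuous_open_preimage[OF continuous_r open_U] by simp
qed

text \<open>Continuity on the closure excludes positive values of \<open>r\<close>, and openness of
  \<Omega> excludes negative ones.\<close>

lemma frontier_zero:
  assumes "p \<in> frontier \<Omega>" shows "p \<in> U" "r p = 0"
proof -
  have p: "p \<in> closure \<Omega>" "p \<notin> \<Omega>"
    using assms open_Omega by (auto simp: frontier_def interior_open)
  show U: "p \<in> U" using p closure_subset_U by blast
  have "r p \<le> 0"
    by (rule continuous_le_on_closure[OF continuous_on_subset[OF continuous_r closure_subset_U] p(1)])
       (use Omega_eq in auto)
  then show "r p = 0" using p(2) U Omega_eq by auto
qed

text \<open>With this normalisation a displacement by \<open>c *s N\<close> changes \<open>r\<close>
  to first order by twice the real part of \<open>c\<close>.\<close>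

lemma ex_normal: "p \<in> frontier \<Omega> \<Longrightarrow> \<exists>N. del_pair r p N = 1"
  using dd_nonzero ex_del_pair_eq_1 linear_dd frontier_zero by metis

end

section \<open>Quadratic discs as competitors for the Kobayashi metric\<close>

lemma kobayashi_le:
  fixes z V Y :: "complex^'n"
  assumes "\<rho> > 0" "\<And>\<zeta>. cmod \<zeta> < \<rho> \<Longrightarrow> z + (\<zeta> *s V + \<zeta>\<^sup>2 *s Y) \<in> \<Omega>"
  shows "kobayashi \<Omega> z V \<le> 1 / \<rho>"
  unfolding kobayashi_def
proof (rule cInf_lower)
  \<comment> \<open>Rescaling the disc of radius \<rho> to the unit disc multiplies the derivative
    at 0 by \<rho>.\<close>
  let ?f = "\<lambda>w. z + ((of_real \<rho> * w) *s V + (of_real \<rho> * w)\<^sup>2 *s Y)"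
  have 1: "?f w $ j = z $ j + (of_real \<rho> * w * V $ j + (of_real \<rho> * w)\<^sup>2 * Y $ j)" for w j by simp
  have d: "((\<lambda>w. ?f w $ j) has_field_derivative
     of_real \<rho> * V $ j + 2 * (of_real \<rho> * w) * of_real \<rho> * Y $ j) (at w)" for w j
    unfolding 1 by (auto intro!: derivative_eq_intros)
  have "(\<lambda>w. ?f w $ j) holomorphic_on ball 0 1" for j
    unfolding 1 by (intro holomorphic_intros)
  moreover have "?f ` ball 0 1 \<subseteq> \<Omega>"
  proof safe
    fix w :: complex assume "w \<in> ball 0 1"
    then have "cmod (of_real \<rho> * w) < \<rho>" using assms(1) by (simp add: norm_mult)
    then show "?f w \<in> \<Omega>" using assms(2) by blast
  qed
  moreover have "deriv (\<lambda>w. ?f w $ j) 0 = complex_of_real \<rho> * V $ j" for j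
    using DERIV_imp_deriv[OF d[of j 0]] by simp
  moreover have "?f 0 = z" by (simp add: vec_eq_iff)
  ultimately show "1 / \<rho> \<in> {1 / l |l. 0 < l \<and>
     (\<exists>f. (\<forall>j. (\<lambda>w. f w $ j) holomorphic_on ball 0 1) \<and> f ` ball 0 1 \<subseteq> \<Omega> \<and> f 0 = z \<and>
        (\<forall>j. deriv (\<lambda>w. f w $ j) 0 = complex_of_real l * V $ j))}"
    unfolding mem_Collect_eq using assms(1)
    by (intro exI[of _ \<rho>] exI[of _ ?f] conjI refl allI)
qed (auto intro!: bdd_belowI[of _ 0])

context C2_domain begin

text \<open>What matters is that \<kappa> and \<rho> do not depend on \<open>t\<close>: as the base
  point approaches \<open>p\<close>, the metric stays bounded although the normal component is only
  of order \<open>sqrt t\<close>.\<close>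

lemma levi_discs:
  assumes p: "p \<in> frontier \<Omega>" and X: "del_pair r p X = 0" and neg: "Re (levi_form r p X) < 0"
    and N: "del_pair r p N = 1"
  shows "\<exists>\<kappa>>0. \<exists>\<rho>>0. \<forall>t. 0 < t \<and> t < \<rho>\<^sup>2 \<longrightarrow>
     p - t *\<^sub>R N \<in> \<Omega> \<and> \<bar>r (p - t *\<^sub>R N)\<bar> \<le> 3 * t \<and>
     kobayashi \<Omega> (p - t *\<^sub>R N) (X + (\<kappa> * sqrt t) *\<^sub>R N) \<le> 1 / \<rho>"
proof -
  note pU = frontier_zero(1)[OF p]
  define q where "q = hol_hess r p X"
  define L where "L = Re (levi_form r p X)"
  \<comment> \<open>The cap at 1 yields both \<open>\<kappa>\<^sup>2 \<le> m / 2\<close> and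
    \<open>m * t \<le> t\<close>, by which the mixed term and the error are absorbed.\<close>
  define m where "m = min 1 (- L)"
  define \<kappa> where "\<kappa> = m / 2"
  define K where "K = norm N * (cmod q + 2)"
  have m: "0 < m" "m \<le> 1" "L \<le> - m" using neg by (auto simp: m_def L_def)
  have \<kappa>: "0 < \<kappa>" "\<kappa> \<le> 1" "\<kappa>\<^sup>2 \<le> m / 2"
    using m mult_left_le[of m m] by (auto simp: \<kappa>_def power2_eq_square)
  have K0: "K \<ge> 0" by (simp add: K_def)
  obtain d where d: "d > 0" and exp: "\<And>\<zeta> k \<sigma>. cmod \<zeta> \<le> \<sigma> \<Longrightarrow> \<sigma> < d \<Longrightarrow> norm k \<le> K * \<sigma>\<^sup>2 \<Longrightarrow>
     p + (\<zeta> *s X + k) \<in> U \<and>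
     \<bar>r (p + (\<zeta> *s X + k)) - (r p + dd r p (\<zeta> *s X + k) + L * (cmod \<zeta>)\<^sup>2 + Re (q * \<zeta>\<^sup>2))\<bar> \<le> m / 8 * \<sigma>\<^sup>2"
    using disc_expansion[OF C2_function_axioms pU K0, of "m / 8" X] m(1) unfolding q_def L_def by auto
  \<comment> \<open>Half of \<open>d\<close>, since |\<zeta>| and \<open>sqrt t\<close> are both
    below \<rho> and their sum has to stay below \<open>d\<close>.\<close>
  define \<rho> where "\<rho> = d / 2"
  have \<rho>: "\<rho> > 0" using d by (simp add: \<rho>_def)
  \<comment> \<open>To first order \<open>\<zeta>\<^sup>2 *s Y\<close> changes \<open>r\<close> by
    \<open>- Re (q * \<zeta>\<^sup>2)\<close>, which is exactly the negative of the harmonic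
    second-order term.\<close>
  define Y where "Y = (- q / 2) *s N"
  have main: "p - t *\<^sub>R N + (\<zeta> *s (X + (\<kappa> * sqrt t) *\<^sub>R N) + \<zeta>\<^sup>2 *s Y) \<in> \<Omega> \<and>
     (\<zeta> = 0 \<longrightarrow> \<bar>r (p - t *\<^sub>R N)\<bar> \<le> 3 * t)"
    if t: "0 < t" "t < \<rho>\<^sup>2" and z: "cmod \<zeta> < \<rho>" for t \<zeta>
  proof -
    define y where "y = sqrt t"
    have y: "0 < y" "y < \<rho>" "y\<^sup>2 = t" using t \<rho> real_less_lsqrt[of \<rho> t] by (auto simp: y_def)
    define \<sigma> where "\<sigma> = cmod \<zeta> + y"
    define k where "k = (\<zeta>\<^sup>2 * (- q / 2) + of_real (\<kappa> * y) * \<zeta> - of_real t) *s N"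
    have eq: "p - t *\<^sub>R N + (\<zeta> *s (X + (\<kappa> * sqrt t) *\<^sub>R N) + \<zeta>\<^sup>2 *s Y) = p + (\<zeta> *s X + k)"
      by (simp add: k_def Y_def y_def vec_eq_iff) (simp add: scaleR_conv_of_real algebra_simps)
    have z2: "(cmod \<zeta>)\<^sup>2 \<le> \<sigma>\<^sup>2" using y by (intro power_mono) (auto simp: \<sigma>_def)
    have t2: "t \<le> \<sigma>\<^sup>2" unfolding y(3)[symmetric] using y by (intro power_mono) (auto simp: \<sigma>_def)
    have yz: "\<kappa> * y * cmod \<zeta> \<le> 1 * \<sigma> * \<sigma>"
      using y \<kappa> by (intro mult_mono) (auto simp: \<sigma>_def)
    have nk: "norm k \<le> K * \<sigma>\<^sup>2"
    proof -
      have "cmod (\<zeta>\<^sup>2 * (- q / 2) + of_real (\<kappa> * y) * \<zeta> - of_real t)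
        \<le> cmod (\<zeta>\<^sup>2 * (- q / 2)) + cmod (of_real (\<kappa> * y) * \<zeta>) + cmod (of_real t)"
        by (intro order_trans[OF norm_triangle_ineq4] add_mono norm_triangle_ineq) auto
      also have "\<dots> = (cmod \<zeta>)\<^sup>2 * (cmod q / 2) + \<kappa> * y * cmod \<zeta> + t"
        using t y \<kappa> by (simp add: norm_mult norm_divide norm_power)
      also have "\<dots> \<le> \<sigma>\<^sup>2 * cmod q + \<sigma>\<^sup>2 + \<sigma>\<^sup>2"
        using z2 t2 yz by (intro add_mono mult_mono) (auto simp: power2_eq_square)
      also have "\<dots> = (cmod q + 2) * \<sigma>\<^sup>2" by (simp add: algebra_simps)
      finally show ?thesis
        unfolding k_def norm_cscale K_def by (simp add: mult_left_mono mult_ac)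
    qed
    have sd: "\<sigma> < d" using y z by (simp add: \<sigma>_def \<rho>_def)
    have zs: "cmod \<zeta> \<le> \<sigma>" using y by (simp add: \<sigma>_def)
    have "dd r p (\<zeta> *s X + k) = 2 * Re (\<zeta>\<^sup>2 * (- q / 2) + of_real (\<kappa> * y) * \<zeta> - of_real t)"
      unfolding dd_del_pair[OF linear_dd[OF pU]] k_def del_pair_add del_pair_scale X N by simp
    also have "\<dots> = - Re (q * \<zeta>\<^sup>2) + 2 * (\<kappa> * y * Re \<zeta>) - 2 * t" by (simp add: field_simps)
    finally have dde: "dd r p (\<zeta> *s X + k) = - Re (q * \<zeta>\<^sup>2) + 2 * (\<kappa> * y * Re \<zeta>) - 2 * t" .
    have E: "p + (\<zeta> *s X + k) \<in> U"
       "\<bar>r (p + (\<zeta> *s X + k)) - (2 * (\<kappa> * y * Re \<zeta>) - 2 * t + L * (cmod \<zeta>)\<^sup>2)\<bar> \<le> m / 8 * \<sigma>\<^sup>2"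
      using exp[OF zs sd nk] unfolding dde frontier_zero(2)[OF p] by argo+
    define w where "w = m * (cmod \<zeta>)\<^sup>2"
    have "\<kappa> * y * Re \<zeta> \<le> y * (\<kappa> * cmod \<zeta>)"
      using y \<kappa> complex_Re_le_cmod[of \<zeta>] by (simp add: mult_left_mono)
    also have "2 * \<dots> \<le> y\<^sup>2 + (\<kappa> * cmod \<zeta>)\<^sup>2"
      using sum_squares_bound[of y "\<kappa> * cmod \<zeta>"] by simp
    also have "(\<kappa> * cmod \<zeta>)\<^sup>2 \<le> m / 2 * (cmod \<zeta>)\<^sup>2"
      unfolding power_mult_distrib using \<kappa>(3) by (intro mult_right_mono) auto
    finally have F1: "2 * (\<kappa> * y * Re \<zeta>) \<le> t + w / 2" using y(3) by (simp add: w_def)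
    have F2: "L * (cmod \<zeta>)\<^sup>2 \<le> - w"
      using mult_right_mono[OF m(3), of "(cmod \<zeta>)\<^sup>2"] by (simp add: w_def)
    have "\<sigma>\<^sup>2 \<le> 2 * ((cmod \<zeta>)\<^sup>2 + t)"
      using sum_squares_bound[of "cmod \<zeta>" y] y(3) by (simp add: \<sigma>_def power2_sum)
    then have "m / 8 * \<sigma>\<^sup>2 \<le> m / 8 * (2 * ((cmod \<zeta>)\<^sup>2 + t))" using m by (intro mult_left_mono) auto
    also have "\<dots> = w / 4 + m * t / 4" by (simp add: w_def algebra_simps)
    finally have F3: "m / 8 * \<sigma>\<^sup>2 \<le> w / 4 + m * t / 4" .
    have F4: "m * t \<le> t" "0 \<le> w" using m t by (auto simp: w_def)
    \<comment> \<open>The bounds add up to at most -3t/4 - w/4: the mixed term costs t + w/2 and the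
      error w/4 + t/4, against the gain 2t + w.\<close>
    have "r (p + (\<zeta> *s X + k)) < 0"
      using E(2) F1 F2 F3 F4 t(1) unfolding w_def[symmetric] abs_le_iff by linarith
    then have "p - t *\<^sub>R N + (\<zeta> *s (X + (\<kappa> * sqrt t) *\<^sub>R N) + \<zeta>\<^sup>2 *s Y) \<in> \<Omega>"
      unfolding eq Omega_eq using E(1) by auto
    moreover have "\<bar>r (p - t *\<^sub>R N)\<bar> \<le> 3 * t" if "\<zeta> = 0"
    proof -
      have "p + (\<zeta> *s X + k) = p - t *\<^sub>R N" using eq that by (simp add: vec_eq_iff)
      moreover have "w = 0" "Re \<zeta> = 0" "cmod \<zeta> = 0" using that by (auto simp: w_def)
      ultimately have "\<bar>r (p - t *\<^sub>R N) - (- 2 * t)\<bar> \<le> t / 4"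
        using E(2) F3 F4 by (simp only: \<open>cmod \<zeta> = 0\<close>) simp
      then show ?thesis using t(1) by linarith
    qed
    ultimately show ?thesis by blast
  qed
  have "p - t *\<^sub>R N \<in> \<Omega> \<and> \<bar>r (p - t *\<^sub>R N)\<bar> \<le> 3 * t \<and>
     kobayashi \<Omega> (p - t *\<^sub>R N) (X + (\<kappa> * sqrt t) *\<^sub>R N) \<le> 1 / \<rho>" if "0 < t" "t < \<rho>\<^sup>2" for t
    using main[OF that, of 0] \<rho> kobayashi_le[OF \<rho>, of "p - t *\<^sub>R N" "X + (\<kappa> * sqrt t) *\<^sub>R N" Y] main[OF that]
    by (auto simp: vec_eq_iff)
  then show ?thesis using \<kappa> \<rho> by blast
qed

text \<open>Suppose the Levi form is negative, put t = y^2 in \<open>levi_discs\<close> and divide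
  the resulting inequality by y. As y tends to 0 the left side tends to \<open>C * \<kappa>\<close>,
  which is positive, and the right side, a multiple of y^(2\<alpha> - 1), tends to 0.\<close>

lemma pseudoconvex_of_kobayashi_lower_bound:
  assumes "C > 0" "\<alpha> > 1/2"
    and bound: "\<And>z X. z \<in> \<Omega> \<Longrightarrow> kobayashi \<Omega> z X \<ge> C * cmod (del_pair r z X) / \<bar>r z\<bar> powr \<alpha>"
  shows "pseudoconvex \<Omega>"
proof -
  have "0 \<le> Re (levi_form r p X)" if p: "p \<in> frontier \<Omega>" and X: "del_pair r p X = 0" for p X
  proof (rule ccontr)
    assume "\<not> 0 \<le> Re (levi_form r p X)"
    moreover obtain N where N: "del_pair r p N = 1" using ex_normal[OF p] by blast
    ultimately obtain \<kappa> \<rho> where k: "\<kappa> > 0" "\<rho> > 0" and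
      disc: "\<And>t. 0 < t \<Longrightarrow> t < \<rho>\<^sup>2 \<Longrightarrow> p - t *\<^sub>R N \<in> \<Omega> \<and> \<bar>r (p - t *\<^sub>R N)\<bar> \<le> 3 * t \<and>
        kobayashi \<Omega> (p - t *\<^sub>R N) (X + (\<kappa> * sqrt t) *\<^sub>R N) \<le> 1 / \<rho>"
      using levi_discs[OF p X _ N] by (meson not_le)
    note pU = frontier_zero(1)[OF p]
    \<comment> \<open>The real differential of \<open>r\<close> along the normal line through
      \<open>p\<close>, applied to a fixed vector.\<close>
    define g where "g v t = dd r (p + t *\<^sub>R (- N)) v" for v t
    have g0: "g X 0 = 0" "g N 0 = 2"
      using dd_del_pair[OF linear_dd[OF pU]] X N by (auto simp: g_def)
    have gd: "\<exists>D. (g v has_real_derivative D) (at 0)" for v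
      unfolding g_def using DERIV_line_dd[of p 0 "- N" v] pU by auto
    have "(g N \<longlongrightarrow> 2) (at 0)"
      using gd[of N] DERIV_isCont isContD g0(2) by metis
    moreover have "((\<lambda>y::real. y\<^sup>2) \<longlongrightarrow> 0) (at_right 0)" by (auto intro!: tendsto_eq_intros)
    then have sq: "filterlim (\<lambda>y::real. y\<^sup>2) (at 0) (at_right 0)"
      by (rule filterlim_atI) (auto simp: eventually_at_filter)
    ultimately have lN: "((\<lambda>y. g N (y\<^sup>2)) \<longlongrightarrow> 2) (at_right 0)"
      using filterlim_compose by blast
    \<comment> \<open>Since \<open>X\<close> is tangential at \<open>p\<close>, \<open>g X t\<close>
      is O(t), so \<open>g X (y\<^sup>2)\<close> is o(y) and cannot offset the normal contribution,
      which is of order y.\<close>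
    obtain D where "((\<lambda>t. g X t / t) \<longlongrightarrow> D) (at 0)"
      using gd[of X] g0(1) by (auto simp: has_field_derivative_iff)
    then have "((\<lambda>y. g X (y\<^sup>2) / y\<^sup>2) \<longlongrightarrow> D) (at_right 0)"
      using sq by (rule filterlim_compose)
    then have "((\<lambda>y. g X (y\<^sup>2) / y\<^sup>2 * y) \<longlongrightarrow> D * 0) (at_right 0)"
      by (intro tendsto_mult tendsto_ident_at)
    then have "((\<lambda>y. g X (y\<^sup>2) / y\<^sup>2 * y) \<longlongrightarrow> 0) (at_right 0)" by simp
    then have lX: "((\<lambda>y. g X (y\<^sup>2) / y) \<longlongrightarrow> 0) (at_right 0)"
      by (rule Lim_transform_eventually) (auto simp: eventually_at_filter power2_eq_square)
    have lhs: "((\<lambda>y. C * ((g X (y\<^sup>2) / y + \<kappa> * g N (y\<^sup>2)) / 2)) \<longlongrightarrow> C * ((0 + \<kappa> * 2) / 2)) (at_right 0)"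
      by (intro tendsto_intros lX lN) auto
    have "((\<lambda>y::real. y powr (2 * \<alpha> - 1)) \<longlongrightarrow> 0) (at_right 0)"
      by (rule tendsto_zero_powrI[where b = "2 * \<alpha> - 1"]) (use assms(2) in \<open>auto simp: eventually_at_filter intro!: tendsto_eq_intros\<close>)
    then have rhs: "((\<lambda>y. 3 powr \<alpha> / \<rho> * y powr (2 * \<alpha> - 1)) \<longlongrightarrow> 3 powr \<alpha> / \<rho> * 0) (at_right 0)"
      by (intro tendsto_intros)
    have ev: "C * ((g X (y\<^sup>2) / y + \<kappa> * g N (y\<^sup>2)) / 2) \<le> 3 powr \<alpha> / \<rho> * y powr (2 * \<alpha> - 1)"
      if y: "0 < y" "y < \<rho>" for y
    proof -
      let ?z = "p - (y\<^sup>2) *\<^sub>R N" and ?V = "X + (\<kappa> * y) *\<^sub>R N"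
      have t: "0 < y\<^sup>2" "y\<^sup>2 < \<rho>\<^sup>2" using y by (auto intro: power_strict_mono)
      have D: "?z \<in> \<Omega>" "\<bar>r ?z\<bar> \<le> 3 * y\<^sup>2" "kobayashi \<Omega> ?z ?V \<le> 1 / \<rho>"
        using disc[OF t] y by auto
      then have zU: "?z \<in> U" and rz: "r ?z < 0" using Omega_eq by auto
      have "C * cmod (del_pair r ?z ?V) / \<bar>r ?z\<bar> powr \<alpha> \<le> 1 / \<rho>"
        using bound[OF D(1), of ?V] D(3) by linarith
      then have "C * cmod (del_pair r ?z ?V) \<le> \<bar>r ?z\<bar> powr \<alpha> / \<rho>"
        using rz k by (simp add: field_simps)
      also have "\<dots> \<le> (3 * y\<^sup>2) powr \<alpha> / \<rho>"
        using D(2) assms(2) k by (intro divide_right_mono powr_mono2) auto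
      also have "(3 * y\<^sup>2) powr \<alpha> = 3 powr \<alpha> * (y powr (2 * \<alpha> - 1) * y)"
      proof -
        have "(3 * y\<^sup>2) powr \<alpha> = 3 powr \<alpha> * y powr (2 * \<alpha>)"
          using y by (simp add: powr_mult powr_powr flip: powr_numeral)
        also have "y powr (2 * \<alpha>) = y powr (2 * \<alpha> - 1) * y powr 1"
          by (simp only: powr_add[symmetric]) simp
        finally show ?thesis using y by simp
      qed
      finally have 1: "C * cmod (del_pair r ?z ?V) \<le> 3 powr \<alpha> * (y powr (2 * \<alpha> - 1) * y) / \<rho>" .
      have "(g X (y\<^sup>2) + (\<kappa> * y) * g N (y\<^sup>2)) / 2 = dd r ?z ?V / 2"
        by (simp add: g_def linear_add[OF linear_dd[OF zU]] linear_scale[OF linear_dd[OF zU]])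
      also have "\<dots> = Re (del_pair r ?z ?V)" using dd_del_pair[OF linear_dd[OF zU]] by simp
      also have "\<dots> \<le> cmod (del_pair r ?z ?V)" by (rule complex_Re_le_cmod)
      finally have "C * ((g X (y\<^sup>2) + (\<kappa> * y) * g N (y\<^sup>2)) / 2) \<le> 3 powr \<alpha> * (y powr (2 * \<alpha> - 1) * y) / \<rho>"
        using 1 assms(1) mult_left_mono order_trans by (smt (verit))
      then have "C * ((g X (y\<^sup>2) + (\<kappa> * y) * g N (y\<^sup>2)) / 2) / y \<le> 3 powr \<alpha> * (y powr (2 * \<alpha> - 1) * y) / \<rho> / y"
        using y by (intro divide_right_mono) auto
      then show ?thesis using y by (simp add: field_simps)
    qed
    have "C * ((0 + \<kappa> * 2) / 2) \<le> 3 powr \<alpha> / \<rho> * 0"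
    proof (rule tendsto_le[OF _ rhs lhs])
      show "\<forall>\<^sub>F y in at_right 0. C * ((g X (y\<^sup>2) / y + \<kappa> * g N (y\<^sup>2)) / 2) \<le> 3 powr \<alpha> / \<rho> * y powr (2 * \<alpha> - 1)"
        using ev eventually_at_right_real[OF k(2)] by (auto elim!: eventually_mono)
    qed auto
    then show False using mult_pos_pos[OF assms(1) k(1)] by simp
  qed
  then show ?thesis
    unfolding pseudoconvex_def using C2_domain_iff C2_domain_axioms by blast
qed

end

text \<open>
  The Levi condition does not depend on the defining function. Instead of relating \<open>r\<close> and \<open>r'\<close> by a
  factor, which is only of class \<open>C\<^sup>1\<close>, the argument compares them along one family of points: if the Levi
  form of \<open>r\<close> were negative, the points \<open>p + \<zeta> X + \<zeta>\<^sup>2 Y + s |\<zeta>|\<^sup>2 N'\<close> would lie in \<open>\<Omega>\<close>, and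
  \<open>r' < 0\<close> there forces \<open>X\<close> to be tangential for \<open>r'\<close> with negative Levi form.
\<close>

lemma levi_condition_transfer:
  fixes \<Omega> :: "(complex^'n) set"
  assumes "C2_domain r U \<Omega>" "C2_domain r' U' \<Omega>" and p: "p \<in> frontier \<Omega>"
    and levi': "\<And>X. del_pair r' p X = 0 \<Longrightarrow> 0 \<le> Re (levi_form r' p X)"
    and X: "del_pair r p X = 0"
  shows "0 \<le> Re (levi_form r p X)"
proof (rule ccontr)
  assume "\<not> 0 \<le> Re (levi_form r p X)"
  interpret C2_domain r U \<Omega> by fact
  interpret R': C2_domain r' U' \<Omega> by fact
  define L where "L = Re (levi_form r p X)"
  define L' where "L' = Re (levi_form r' p X)"
  define q where "q = hol_hess r p X"
  define q' where "q' = hol_hess r' p X"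
  have L: "L < 0" using \<open>\<not> 0 \<le> Re (levi_form r p X)\<close> by (simp add: L_def)
  note pU = frontier_zero(1)[OF p] and pU' = R'.frontier_zero(1)[OF p]
  note ld = linear_dd[OF pU] and ld' = R'.linear_dd[OF pU']
  obtain N where N: "del_pair r p N = 1" using ex_normal[OF p] by blast
  obtain N' where "del_pair r' p N' = 1" using R'.ex_normal[OF p] by blast
  then have N': "dd r' p N' = 2" using dd_del_pair[OF ld'] by simp
  \<comment> \<open>The shift along \<open>N'\<close> is small enough for \<open>r\<close> to remain
    at most \<open>(L / 2) * (cmod \<zeta>)\<^sup>2\<close>. It raises \<open>r'\<close> to first
    order by 2s|\<zeta>|^2, of which the remainder of \<open>r'\<close> consumes at most one
    half.\<close>
  define s where "s = - L / (4 * (\<bar>dd r p N'\<bar> + 1))"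
  have s: "s > 0" "s * dd r p N' \<le> - L / 4"
  proof -
    show "s > 0" unfolding s_def using L by (intro divide_pos_pos) (auto simp: add_nonneg_pos)
    then have "s * dd r p N' \<le> s * (\<bar>dd r p N'\<bar> + 1)" by (intro mult_left_mono) auto
    also have "\<dots> = - L / 4" by (simp add: s_def field_simps)
    finally show "s * dd r p N' \<le> - L / 4" .
  qed
  define Y where "Y = (- q / 2) *s N"
  define k where "k \<zeta> = \<zeta>\<^sup>2 *s Y + (s * (cmod \<zeta>)\<^sup>2) *\<^sub>R N'" for \<zeta>
  define K where "K = norm Y + s * norm N'"
  have K0: "0 \<le> K" using s by (simp add: K_def)
  have nk: "norm (k \<zeta>) \<le> K * (cmod \<zeta>)\<^sup>2" for \<zeta>
    unfolding k_def K_def using s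
    by (intro order_trans[OF norm_triangle_ineq]) (simp add: norm_cscale norm_power algebra_simps)
  obtain d1 where d1: "d1 > 0" and exp: "\<And>\<zeta>. cmod \<zeta> < d1 \<Longrightarrow>
     p + (\<zeta> *s X + k \<zeta>) \<in> U \<and>
     \<bar>r (p + (\<zeta> *s X + k \<zeta>)) - (r p + dd r p (\<zeta> *s X + k \<zeta>) + L * (cmod \<zeta>)\<^sup>2 + Re (q * \<zeta>\<^sup>2))\<bar>
       \<le> (- L / 4) * (cmod \<zeta>)\<^sup>2"
    using disc_expansion[OF C2_function_axioms pU K0, of "- L / 4" X] L nk unfolding q_def L_def
    by (metis divide_pos_pos neg_0_less_iff_less order_refl zero_less_numeral)
  obtain d2 where d2: "d2 > 0" and exp': "\<And>\<zeta>. cmod \<zeta> < d2 \<Longrightarrow>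
     \<bar>r' (p + (\<zeta> *s X + k \<zeta>)) - (r' p + dd r' p (\<zeta> *s X + k \<zeta>) + L' * (cmod \<zeta>)\<^sup>2 + Re (q' * \<zeta>\<^sup>2))\<bar>
       \<le> s * (cmod \<zeta>)\<^sup>2"
    using disc_expansion[OF R'.C2_function_axioms pU' K0 s(1), of X] nk unfolding q'_def L'_def
    by (metis order_refl)
  define d where "d = min d1 d2"
  have d: "d > 0" using d1 d2 by (simp add: d_def)
  have inO: "p + (\<zeta> *s X + k \<zeta>) \<in> \<Omega>" if z: "\<zeta> \<noteq> 0" "cmod \<zeta> < d" for \<zeta>
  proof -
    have "dd r p (\<zeta> *s X + k \<zeta>) = - Re (q * \<zeta>\<^sup>2) + s * dd r p N' * (cmod \<zeta>)\<^sup>2"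
      unfolding k_def linear_add[OF ld] linear_scale[OF ld] dd_del_pair[OF ld, of "_ *s _"] Y_def
        del_pair_scale X N
      by (simp add: field_simps)
    then have "r (p + (\<zeta> *s X + k \<zeta>)) \<le> (s * dd r p N' + L - L / 4) * (cmod \<zeta>)\<^sup>2"
      using exp[of \<zeta>] z frontier_zero(2)[OF p] by (auto simp: d_def abs_le_iff algebra_simps)
    also have "\<dots> \<le> (L / 2) * (cmod \<zeta>)\<^sup>2" using s(2) by (intro mult_right_mono) auto
    also have "\<dots> < 0" using L z by (simp add: mult_neg_pos)
    finally show ?thesis using exp[of \<zeta>] z Omega_eq by (auto simp: d_def)
  qed
  have neg: "dd r' p (\<zeta> *s X) + (dd r' p (\<zeta>\<^sup>2 *s Y) + Re (q' * \<zeta>\<^sup>2)) + (s + L') * (cmod \<zeta>)\<^sup>2 < 0"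
    if z: "\<zeta> \<noteq> 0" "cmod \<zeta> < d" for \<zeta>
  proof -
    have "dd r' p (\<zeta> *s X + k \<zeta>) = dd r' p (\<zeta> *s X) + dd r' p (\<zeta>\<^sup>2 *s Y) + 2 * s * (cmod \<zeta>)\<^sup>2"
      unfolding k_def linear_add[OF ld'] linear_scale[OF ld'] N' by simp
    moreover have "r' (p + (\<zeta> *s X + k \<zeta>)) < 0" using inO[OF z] R'.Omega_eq by auto
    ultimately show ?thesis
      using exp'[of \<zeta>] z R'.frontier_zero(2)[OF p] by (auto simp: d_def abs_le_iff algebra_simps)
  qed
  define M where "M = 2 * cmod (del_pair r' p Y) + cmod q' + \<bar>s + L'\<bar>"
  \<comment> \<open>The first-order part of \<open>r'\<close> is bounded above by a quadratic term
    in every complex direction, which forces it to vanish.\<close>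
  have up: "dd r' p (\<zeta> *s X) \<le> M * (cmod \<zeta>)\<^sup>2" if z: "\<zeta> \<noteq> 0" "cmod \<zeta> < d" for \<zeta>
  proof -
    have "\<bar>Re (\<zeta>\<^sup>2 * del_pair r' p Y)\<bar> \<le> cmod (del_pair r' p Y) * (cmod \<zeta>)\<^sup>2"
      "\<bar>Re (q' * \<zeta>\<^sup>2)\<bar> \<le> cmod q' * (cmod \<zeta>)\<^sup>2"
      using abs_Re_le_cmod[of "\<zeta>\<^sup>2 * del_pair r' p Y"] abs_Re_le_cmod[of "q' * \<zeta>\<^sup>2"]
      by (simp_all only: norm_mult norm_power mult.commute)
    moreover have "- (s + L') * (cmod \<zeta>)\<^sup>2 \<le> \<bar>s + L'\<bar> * (cmod \<zeta>)\<^sup>2" by (intro mult_right_mono) auto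
    ultimately show ?thesis
      using neg[OF z] unfolding dd_del_pair[OF ld', of "_ *s Y"] del_pair_scale M_def
      by (auto simp: abs_le_iff algebra_simps)
  qed
  have M0: "M \<ge> 0" by (simp add: M_def)
  have le0: "2 * Re (c * del_pair r' p X) \<le> 0" if c: "cmod c = 1" for c
  proof (rule ccontr)
    assume a: "\<not> ?thesis"
    have "c \<noteq> 0" using c by auto
    define b where "b = 2 * Re (c * del_pair r' p X)"
    have b: "b > 0" using a by (simp add: b_def)
    define x where "x = min (d / 2) (b / (2 * (M + 1)))"
    have x: "x > 0" "x < d" using d b M0 by (auto simp: x_def)
    have "x \<le> b / (2 * (M + 1))" by (simp add: x_def)
    then have "x * (2 * (M + 1)) \<le> b" using M0 by (simp add: field_simps)
    then have "x * M < b" using x mult_nonneg_nonneg[of x M] M0 unfolding distrib_left distrib_right by linarith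
    moreover have "x * b \<le> x * (x * M)"
      using up[of "of_real x * c"] x c \<open>c \<noteq> 0\<close> unfolding dd_del_pair[OF ld'] del_pair_scale b_def
      by (auto simp: norm_mult power2_eq_square algebra_simps)
    then have "b \<le> x * M" using x by simp
    ultimately show False by simp
  qed
  \<comment> \<open>The four rotations by 1, -1, \<i> and -\<i> bound the real and imaginary parts
    from both sides.\<close>
  have "del_pair r' p X = 0"
    using le0[of 1] le0[of "-1"] le0[of \<i>] le0[of "- \<i>"] by (simp add: complex_eq_iff)
  then have "0 \<le> L'" using levi' by (simp add: L'_def)
  moreover have z: "cmod (of_real (d/2)) < d" "cmod (of_real (d/2) * \<i>) < d" "of_real (d/2) \<noteq> (0::complex)"
    using d by (auto simp: norm_mult)
  have i2: "(of_real (d/2) * \<i>)\<^sup>2 = - ((of_real (d/2))\<^sup>2 :: complex)"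
    unfolding power_mult_distrib by simp
  \<comment> \<open>Adding the inequalities for \<zeta> and \<i>\<zeta> cancels every term in
    \<zeta>^2 and leaves only the multiples of |\<zeta>|^2.\<close>
  have "(s + L') * (d/2)\<^sup>2 < 0"
    using neg[of "of_real (d/2)"] neg[of "of_real (d/2) * \<i>"] z d \<open>del_pair r' p X = 0\<close>
    unfolding dd_del_pair[OF ld'] del_pair_scale i2
    by (simp add: norm_mult)
  then have "s + L' < 0" using d by (simp add: mult_less_0_iff)
  ultimately show False using s by simp
qed

section \<open>The lower bound on pseudoconvex domains\<close>

lemma del_pair_diff_le:
  assumes "linear (dd r z)" "linear (dd r z')"
    and "\<And>v. \<bar>dd r z v - dd r z' v\<bar> \<le> M * norm v"
  shows "cmod (del_pair r z X - del_pair r z' X) \<le> M * norm X"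
proof -
  have "2 * Re (del_pair r z X - del_pair r z' X) = dd r z X - dd r z' X"
    using dd_del_pair[OF assms(1)] dd_del_pair[OF assms(2)] by simp
  moreover have "2 * Im (del_pair r z X - del_pair r z' X) = - (dd r z (\<i> *s X) - dd r z' (\<i> *s X))"
    using dd_del_pair[OF assms(1), of "\<i> *s X"] dd_del_pair[OF assms(2), of "\<i> *s X"] by (simp add: del_pair_scale)
  moreover have "\<bar>dd r z (\<i> *s X) - dd r z' (\<i> *s X)\<bar> \<le> M * norm X"
    using assms(3)[of "\<i> *s X"] by (simp add: norm_cscale)
  ultimately show ?thesis
    using assms(3)[of X] cmod_le[of "del_pair r z X - del_pair r z' X"] by linarith
qed

section \<open>Cauchy estimates for bounded discs\<close>

lemma holomorphic_Taylor_bound: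
  assumes hol: "f holomorphic_on ball 0 1" and R: "\<And>w. w \<in> ball 0 1 \<Longrightarrow> cmod (f w) \<le> R"
  shows "cmod (deriv f 0) \<le> 4 * R" "cmod ((deriv ^^ 2) f 0) \<le> 32 * R"
    "cmod \<zeta> < 1/2 \<Longrightarrow> cmod (f \<zeta> - (f 0 + \<zeta> * deriv f 0 + \<zeta>\<^sup>2 * ((deriv ^^ 2) f 0 / 2))) \<le> 192 * R * cmod \<zeta> ^ 3"
proof -
  \<comment> \<open>Circles of radius 1/4 about points with |x| < 1/2 stay inside the unit disc.
    This produces the constants 4, 2 * 4^2 = 32 and 3! * 4^3 / 2! = 192.\<close>
  have C: "cmod ((deriv ^^ n) f x) \<le> fact n * R / (1/4) ^ n" if "x \<in> ball 0 (1/2)" for n x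
  proof (rule Cauchy_inequality)
    have s: "cball x (1/4) \<subseteq> ball 0 1"
    proof
      fix w assume "w \<in> cball x (1/4)"
      then have "norm (w - x) \<le> 1/4" by (simp add: dist_norm norm_minus_commute)
      then show "w \<in> ball 0 1" using that norm_triangle_ineq[of "w - x" x] by simp
    qed
    then show "f holomorphic_on ball x (1/4)"
      by (meson ball_subset_cball hol holomorphic_on_subset order_trans)
    show "continuous_on (cball x (1/4)) f"
      using s hol by (meson holomorphic_on_imp_continuous_on holomorphic_on_subset)
    show "cmod (f w) \<le> R" if "cmod (x - w) = 1/4" for w
      using s that by (intro R) (auto simp: dist_norm subset_iff)
  qed auto
  show "cmod (deriv f 0) \<le> 4 * R" using C[of 0 1] by simp
  show "cmod ((deriv ^^ 2) f 0) \<le> 32 * R" using C[of 0 2] by (simp add: power2_eq_square)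
  assume z: "cmod \<zeta> < 1/2"
  have "cmod ((deriv ^^ 0) f \<zeta> - (\<Sum>i\<le>2. (deriv ^^ i) f 0 * (\<zeta> - 0) ^ i / fact i))
      \<le> (fact 3 * R / (1/4) ^ 3) * cmod (\<zeta> - 0) ^ Suc 2 / fact 2"
  proof (rule complex_Taylor[of "ball 0 (1/2)"])
    fix i and x :: complex assume x: "x \<in> ball 0 (1/2)"
    have "x \<in> ball 0 1" using x by simp
    then have "(deriv ^^ i) f field_differentiable at x"
      using holomorphic_higher_deriv[OF hol open_ball] open_ball holomorphic_on_imp_differentiable_at by blast
    then show "((deriv ^^ i) f has_field_derivative (deriv ^^ Suc i) f x) (at x within ball 0 (1/2))"
      by (simp add: DERIV_deriv_iff_field_differentiable has_field_derivative_at_within)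
  next
    fix x :: complex assume "x \<in> ball 0 (1/2)"
    then show "cmod ((deriv ^^ Suc 2) f x) \<le> fact 3 * R / (1/4) ^ 3"
      using C[of x 3] by (simp add: numeral_3_eq_3 numeral_2_eq_2)
  qed (use z in auto)
  then show "cmod (f \<zeta> - (f 0 + \<zeta> * deriv f 0 + \<zeta>\<^sup>2 * ((deriv ^^ 2) f 0 / 2))) \<le> 192 * R * cmod \<zeta> ^ 3"
    by (simp add: numeral_2_eq_2 numeral_3_eq_3 fact_numeral mult_ac)
qed

lemma norm_cvec_le:
  fixes x :: "complex^'n"
  assumes "\<And>j. cmod (x $ j) \<le> b"
  shows "norm x \<le> real CARD('n) * b"
proof -
  have "norm x \<le> (\<Sum>j\<in>UNIV. cmod (x $ j))"
    unfolding norm_vec_def by (rule L2_set_le_sum) auto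
  also have "\<dots> \<le> real CARD('n) * b" using sum_mono[of UNIV "\<lambda>j. cmod (x $ j)" "\<lambda>_. b"] assms by simp
  finally show ?thesis .
qed

text \<open>The single constant \<open>B\<close> depends only on the dimension and on the size of
  the target, so it serves all discs in a bounded domain at once.\<close>

lemma disc_Taylor:
  fixes f :: "complex \<Rightarrow> complex^'n"
  assumes hol: "\<And>j. (\<lambda>w. f w $ j) holomorphic_on ball 0 1"
    and R: "\<And>w. w \<in> ball 0 1 \<Longrightarrow> norm (f w) \<le> R"
  defines "W \<equiv> \<chi> j. deriv (\<lambda>w. f w $ j) 0"
  defines "Y \<equiv> \<chi> j. (deriv ^^ 2) (\<lambda>w. f w $ j) 0 / 2"
  defines "B \<equiv> real CARD('n) * (192 * R)"
  shows "norm W \<le> B" "norm Y \<le> B"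
    "cmod \<zeta> < 1/2 \<Longrightarrow> norm (f \<zeta> - (f 0 + \<zeta> *s W + \<zeta>\<^sup>2 *s Y)) \<le> B * cmod \<zeta> ^ 3"
proof -
  have Rj: "cmod (f w $ j) \<le> R" if "w \<in> ball 0 1" for w j
    using R[OF that] Finite_Cartesian_Product.norm_nth_le[of "f w" j] by linarith
  have R0: "0 \<le> R" using R[of 0] norm_ge_zero order_trans by (metis centre_in_ball zero_less_one)
  note T = holomorphic_Taylor_bound[OF hol Rj]
  show "norm W \<le> B" unfolding B_def
    by (rule norm_cvec_le) (use order_trans[OF T(1), of "192 * R"] R0 in \<open>auto simp: W_def\<close>)
  show "norm Y \<le> B" unfolding B_def
    by (rule norm_cvec_le) (use order_trans[OF T(2), of "384 * R"] R0 in \<open>auto simp: Y_def norm_divide\<close>)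
  assume z: "cmod \<zeta> < 1/2"
  have "norm (f \<zeta> - (f 0 + \<zeta> *s W + \<zeta>\<^sup>2 *s Y)) \<le> real CARD('n) * (192 * R * cmod \<zeta> ^ 3)"
    by (rule norm_cvec_le) (use T(3)[OF _ z] in \<open>auto simp: W_def Y_def\<close>)
  then show "norm (f \<zeta> - (f 0 + \<zeta> *s W + \<zeta>\<^sup>2 *s Y)) \<le> B * cmod \<zeta> ^ 3"
    by (simp add: B_def mult_ac)
qed

text \<open>Points are written as \<open>x + h\<close> with \<open>x\<close> in the closure, so that
  a segment from \<open>x\<close> to \<open>x + h\<close> stays where the bounds hold, whatever the
  shape of \<Omega>.\<close>

locale C3_domain_bounds = C3_function r U + C2_domain r U \<Omega> for r :: "complex^'n \<Rightarrow> real" and U \<Omega> +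
  fixes d M :: real
  assumes bounded_Omega: "bounded \<Omega>" and d_pos: "d > 0" and M_pos: "M > 0"
    and near_U: "\<And>x h. x \<in> closure \<Omega> \<Longrightarrow> norm h \<le> d \<Longrightarrow> x + h \<in> U"
    and dd_M: "\<And>x h v. x \<in> closure \<Omega> \<Longrightarrow> norm h \<le> d \<Longrightarrow> \<bar>dd r (x + h) v\<bar> \<le> M * norm v"
    and dd2_M: "\<And>x h v w. x \<in> closure \<Omega> \<Longrightarrow> norm h \<le> d \<Longrightarrow> \<bar>dd2 r (x + h) v w\<bar> \<le> M * norm v * norm w"
    and dd3_M: "\<And>x h u v w. x \<in> closure \<Omega> \<Longrightarrow> norm h \<le> d \<Longrightarrow>
        \<bar>dd3 r (x + h) u v w\<bar> \<le> M * norm u * norm v * norm w"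

text \<open>A closed neighbourhood of the compact closure is a compact subset of \<open>U\<close>,
  on which the continuous coefficient sums are bounded.\<close>

lemma ex_C3_domain_bounds:
  fixes r :: "complex^'n \<Rightarrow> real"
  assumes "C3_function r U" "C2_domain r U \<Omega>" "bounded \<Omega>"
  shows "\<exists>d M. C3_domain_bounds r U \<Omega> d M"
proof -
  interpret C3_function r U by fact
  interpret C2_domain r U \<Omega> by fact
  have "compact (closure \<Omega>)" using assms(3) by simp
  then obtain d where d: "d > 0" "(\<Union>x\<in>closure \<Omega>. cball x d) \<subseteq> U"
    using compact_subset_open_imp_cball_epsilon_subset open_U closure_subset_U by metis
  define K where "K = (\<Union>x\<in>closure \<Omega>. \<Union>h\<in>cball 0 d. {x + h})"
  have "compact K" unfolding K_def using \<open>compact (closure \<Omega>)\<close> by (intro compact_sums') auto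
  have KU: "K \<subseteq> U" unfolding K_def using d(2) by (fastforce simp: dist_norm)
  define b1 where "b1 x = (\<Sum>b\<in>Basis. \<bar>dd r x b\<bar>)" for x
  have b1: "\<bar>dd r x v\<bar> \<le> b1 x * norm v" if "x \<in> U" for x v
    unfolding b1_def using linear_bound_basis[OF linear_dd[OF that]] .
  have "continuous_on K b1" "continuous_on K bnd2" "continuous_on K bnd3"
    unfolding b1_def
    by (intro continuous_on_subset[OF _ KU] continuous_intros continuous_dd continuous_bnd2 continuous_bnd3)+
  then have bd: "bounded (b1 ` K)" "bounded (bnd2 ` K)" "bounded (bnd3 ` K)"
    using \<open>compact K\<close> by (simp_all add: compact_continuous_image compact_imp_bounded)
  obtain B1 where B1: "\<forall>x\<in>K. \<bar>b1 x\<bar> \<le> B1" using bd(1) unfolding bounded_iff by auto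
  obtain B2 where B2: "\<forall>x\<in>K. \<bar>bnd2 x\<bar> \<le> B2" using bd(2) unfolding bounded_iff by auto
  obtain B3 where B3: "\<forall>x\<in>K. \<bar>bnd3 x\<bar> \<le> B3" using bd(3) unfolding bounded_iff by auto
  define M where "M = max 1 (max B1 (max B2 B3))"
  have K: "x + h \<in> K" if "x \<in> closure \<Omega>" "norm h \<le> d" for x h
    using that unfolding K_def by (simp, intro bexI[of _ x] bexI[of _ h]) auto
  have "C3_domain_bounds r U \<Omega> d M"
  proof unfold_locales
    fix x h u v w :: "complex^'n" assume xh: "x \<in> closure \<Omega>" "norm h \<le> d"
    then have k: "x + h \<in> K" using K by blast
    then show u: "x + h \<in> U" using KU by blast
    have m: "b1 (x + h) \<le> M" "bnd2 (x + h) \<le> M" "bnd3 (x + h) \<le> M"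
      using bspec[OF B1 k] bspec[OF B2 k] bspec[OF B3 k] by (auto simp: M_def)
    show "\<bar>dd r (x + h) v\<bar> \<le> M * norm v"
      using b1[OF u, of v] mult_right_mono[OF m(1), of "norm v"] by simp
    show "\<bar>dd2 r (x + h) v w\<bar> \<le> M * norm v * norm w"
      using dd2_bound[OF u, of v w] mult_right_mono[OF m(2), of "norm v * norm w"] by (simp add: mult_ac)
    show "\<bar>dd3 r (x + h) u v w\<bar> \<le> M * norm u * norm v * norm w"
      using dd3_bound[OF u, of u v w] mult_right_mono[OF m(3), of "norm u * norm v * norm w"] by (simp add: mult_ac)
  qed (use assms(3) d(1) in \<open>auto simp: M_def\<close>)
  then show ?thesis by blast
qed

context C3_domain_bounds begin

lemma in_U: "x \<in> closure \<Omega> \<Longrightarrow> x \<in> U" using closure_subset_U by blast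

lemma dd_M0: "x \<in> closure \<Omega> \<Longrightarrow> \<bar>dd r x v\<bar> \<le> M * norm v"
  using dd_M[of x 0 v] d_pos by simp

lemma dd2_M0: "x \<in> closure \<Omega> \<Longrightarrow> \<bar>dd2 r x v w\<bar> \<le> M * norm v * norm w"
  using dd2_M[of x 0 v w] d_pos by simp

lemma line_le: "0 \<le> t \<Longrightarrow> t \<le> 1 \<Longrightarrow> norm h \<le> d \<Longrightarrow> norm (t *\<^sub>R h) \<le> d"
  for h :: "complex^'n"
  using mult_left_le_one_le[of "norm h" t] by simp

text \<open>Stated as a lower bound because it is combined with \<open>r < 0\<close> along a disc in
  \<open>disc_estimate\<close>.\<close>

lemma Taylor3_bound:
  assumes "x \<in> closure \<Omega>" "norm h \<le> d"
  shows "r x + dd r x h + dd2 r x h h / 2 - M * norm h ^ 3 \<le> r (x + h)"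
proof -
  obtain t where t: "0 < t" "t \<le> 1"
    "r (x + h) = r x + dd r x h + dd2 r x h h / 2 + dd3 r (x + t *\<^sub>R h) h h h / 6"
    using Taylor3_line[of x h] near_U line_le assms by meson
  have "\<bar>dd3 r (x + t *\<^sub>R h) h h h\<bar> \<le> M * norm h ^ 3"
    using dd3_M[OF assms(1) line_le[OF _ t(2) assms(2)], of h h h] t(1) by (simp add: power3_eq_cube mult_ac)
  then show ?thesis unfolding t(3) by linarith
qed

lemma dd_lipschitz:
  assumes "x \<in> closure \<Omega>" "norm h \<le> d"
  shows "\<bar>dd r (x + h) v - dd r x v\<bar> \<le> M * norm h * norm v"
proof -
  obtain t where t: "0 < t" "t < 1" "dd r (x + h) v = dd r x v + dd2 r (x + t *\<^sub>R h) v h"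
    using dd_lipschitz_line[of x h] near_U line_le assms by meson
  show ?thesis
    using dd2_M[OF assms(1) line_le[OF _ _ assms(2)], of t v h] t by (simp add: mult_ac)
qed

lemma dd2_lipschitz:
  assumes "x \<in> closure \<Omega>" "norm h \<le> d"
  shows "\<bar>dd2 r (x + h) u v - dd2 r x u v\<bar> \<le> M * norm h * norm u * norm v"
proof -
  obtain t where t: "0 < t" "t < 1" "dd2 r (x + h) u v = dd2 r x u v + dd3 r (x + t *\<^sub>R h) u v h"
    using dd2_lipschitz_line[of x h] near_U line_le assms by meson
  show ?thesis
    using dd3_M[OF assms(1) line_le[OF _ _ assms(2)], of t u v h] t by (simp add: mult_ac)
qed

section \<open>Geometry near the boundary\<close>

lemma frontier_direction:
  "\<exists>c>0. \<forall>p\<in>frontier \<Omega>. \<exists>\<nu>. norm \<nu> = 1 \<and> c \<le> dd r p \<nu>"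
proof -
  define G where "G p = (\<Sum>b\<in>Basis. \<bar>dd r p b\<bar>)" for p
  have cpt: "compact (frontier \<Omega>)" using bounded_Omega compact_frontier_bounded by blast
  have cont: "continuous_on (frontier \<Omega>) G"
    unfolding G_def using frontier_zero(1)
    by (intro continuous_on_subset[where s=U and t="frontier \<Omega>"] continuous_intros continuous_dd) auto
  have pos: "G p > 0" if p: "p \<in> frontier \<Omega>" for p
  proof (rule ccontr)
    obtain v where v: "dd r p v \<noteq> 0" using dd_nonzero[OF p] by blast
    assume "\<not> G p > 0"
    then have "G p * norm v \<le> 0" by (simp add: mult_nonpos_nonneg)
    then show False
      using v linear_bound_basis[OF linear_dd[OF frontier_zero(1)[OF p]], of v] unfolding G_def by auto
  qed
  have "\<exists>c0>0. \<forall>p\<in>frontier \<Omega>. c0 \<le> G p"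
  proof (cases "frontier \<Omega> = {}")
    case False
    then show ?thesis using continuous_attains_inf[OF cpt False cont] pos by meson
  qed (auto intro: exI[of _ 1])
  then obtain c0 where c0: "c0 > 0" "\<And>p. p \<in> frontier \<Omega> \<Longrightarrow> c0 \<le> G p" by blast
  \<comment> \<open>Some basis derivative is at least the average of all of them in absolute value.
    Its sign is corrected by passing to the opposite vector.\<close>
  define c where "c = c0 / DIM(complex^'n)"
  have c: "c > 0" using c0 by (simp add: c_def)
  have "\<exists>\<nu>. norm \<nu> = 1 \<and> c \<le> dd r p \<nu>" if p: "p \<in> frontier \<Omega>" for p
  proof -
    have "\<exists>b\<in>Basis. c \<le> \<bar>dd r p b\<bar>"
    proof (rule ccontr)
      assume "\<not> ?thesis"
      then have "G p < of_nat DIM(complex^'n) * c"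
        unfolding G_def by (intro sum_bounded_above_strict) auto
      then show False using c0(2)[OF p] by (simp add: c_def)
    qed
    then obtain b where b: "b \<in> Basis" "c \<le> \<bar>dd r p b\<bar>" by blast
    have "dd r p (- b) = - dd r p b" using linear_neg[OF linear_dd[OF frontier_zero(1)[OF p]]] .
    then show ?thesis using b by (cases "dd r p b \<ge> 0") (auto intro: exI[of _ b] exI[of _ "- b"])
  qed
  then show ?thesis using c by blast
qed

text \<open>Close to the boundary \<open>r\<close> grows at rate at least c/2 along a suitable unit
  vector, so a walk of length 2|r z|/c leaves \<Omega> and crosses the frontier on the way.\<close>

lemma near_frontier_point:
  "\<exists>\<epsilon>>0. \<exists>K>0. \<forall>z\<in>\<Omega>. \<bar>r z\<bar> < \<epsilon> \<longrightarrow> (\<exists>p\<in>frontier \<Omega>. norm (z - p) \<le> K * \<bar>r z\<bar>)"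
proof -
  obtain c where c: "c > 0" "\<And>p. p \<in> frontier \<Omega> \<Longrightarrow> \<exists>\<nu>. norm \<nu> = 1 \<and> c \<le> dd r p \<nu>"
    using frontier_direction by blast
  \<comment> \<open>Within distance \<open>2 * \<delta>\<close> of a frontier point the bounds
    \<open>M\<close> apply and the directional derivative drops by at most c/2.\<close>
  define \<delta> where "\<delta> = min (d / 2) (c / (4 * M))"
  have \<delta>: "\<delta> > 0" "2 * \<delta> \<le> d" using d_pos c M_pos by (auto simp: \<delta>_def)
  have "\<delta> \<le> c / (4 * M)" by (simp add: \<delta>_def)
  then have M\<delta>: "M * (2 * \<delta>) \<le> c / 2" using M_pos by (simp add: field_simps)
  \<comment> \<open>The points far from the frontier form a compact subset of \<Omega>, on which |r|
    has a positive minimum. A small value of |r z| therefore forces \<open>z\<close> near the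
    frontier.\<close>
  define S where "S = closure \<Omega> \<inter> (\<Inter>q\<in>frontier \<Omega>. {z. \<delta> \<le> dist z q})"
  have "closed (\<Inter>q\<in>frontier \<Omega>. {z. \<delta> \<le> dist z q})"
    by (intro closed_INT ballI closed_Collect_le continuous_intros)
  then have "compact S" unfolding S_def using bounded_Omega by (intro compact_Int_closed) auto
  have SO: "S \<subseteq> \<Omega>"
  proof
    fix z assume z: "z \<in> S"
    have "z \<notin> frontier \<Omega>" using z \<delta>(1) unfolding S_def by auto
    then show "z \<in> \<Omega>" using z open_Omega unfolding S_def frontier_def by (auto simp: interior_open)
  qed
  have "\<exists>\<epsilon>1>0. \<forall>z\<in>S. \<epsilon>1 \<le> \<bar>r z\<bar>"
  proof (cases "S = {}")
    case False
    have "continuous_on S (\<lambda>z. \<bar>r z\<bar>)"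
      using SO Omega_eq by (intro continuous_intros continuous_on_subset[OF continuous_r]) auto
    then obtain s where "s \<in> S" "\<forall>z\<in>S. \<bar>r s\<bar> \<le> \<bar>r z\<bar>"
      using continuous_attains_inf[OF \<open>compact S\<close> False] by meson
    moreover have "\<bar>r s\<bar> > 0" using \<open>s \<in> S\<close> SO Omega_eq by auto
    ultimately show ?thesis by blast
  qed (auto intro: exI[of _ 1])
  then obtain \<epsilon>1 where e1: "\<epsilon>1 > 0" "\<And>z. z \<in> S \<Longrightarrow> \<epsilon>1 \<le> \<bar>r z\<bar>" by blast
  have "\<exists>p\<in>frontier \<Omega>. norm (z - p) \<le> 2 / c * \<bar>r z\<bar>"
    if z: "z \<in> \<Omega>" and rz: "\<bar>r z\<bar> < min \<epsilon>1 (c * \<delta> / 2)" for z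
  proof -
    have rneg: "r z < 0" using z Omega_eq by auto
    have "z \<notin> S" using e1(2) rz by force
    then obtain q where q: "q \<in> frontier \<Omega>" "dist z q < \<delta>"
      using z closure_subset unfolding S_def by (auto simp: not_le)
    obtain \<nu> where \<nu>: "norm \<nu> = 1" "c \<le> dd r q \<nu>" using c(2)[OF q(1)] by blast
    have qc: "q \<in> closure \<Omega>" using q(1) by (simp add: frontier_def)
    define t1 where "t1 = 2 / c * \<bar>r z\<bar>"
    have t1: "0 < t1" "t1 < \<delta>" using rneg rz c by (auto simp: t1_def field_simps)
    have near: "norm (z + t *\<^sub>R \<nu> - q) \<le> 2 * \<delta>" if "0 \<le> t" "t \<le> t1" for t
    proof -
      have "norm (z + t *\<^sub>R \<nu> - q) \<le> norm (z - q) + norm (t *\<^sub>R \<nu>)"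
        using norm_triangle_ineq[of "z - q" "t *\<^sub>R \<nu>"] by (simp add: algebra_simps)
      then show ?thesis using q(2) \<nu>(1) that t1 by (simp add: dist_norm)
    qed
    have inU: "z + t *\<^sub>R \<nu> \<in> U" if "0 \<le> t" "t \<le> t1" for t
      using near_U[OF qc, of "z + t *\<^sub>R \<nu> - q"] near[OF that] \<delta> by simp
    have "\<exists>t. 0 < t \<and> t < t1 \<and> r (z + t1 *\<^sub>R \<nu>) - r (z + 0 *\<^sub>R \<nu>) = (t1 - 0) * dd r (z + t *\<^sub>R \<nu>) \<nu>"
      using t1 inU DERIV_line by (intro MVT2) auto
    then obtain t where t: "0 < t" "t < t1" "r (z + t1 *\<^sub>R \<nu>) = r z + t1 * dd r (z + t *\<^sub>R \<nu>) \<nu>"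
      by (auto simp: algebra_simps)
    have "\<bar>dd r (z + t *\<^sub>R \<nu>) \<nu> - dd r q \<nu>\<bar> \<le> M * norm (z + t *\<^sub>R \<nu> - q)"
      using dd_lipschitz[OF qc, of "z + t *\<^sub>R \<nu> - q" \<nu>] near[of t] t \<delta> \<nu>(1) by simp
    also have "\<dots> \<le> M * (2 * \<delta>)" using near[of t] t M_pos by (intro mult_left_mono) auto
    finally have "c / 2 \<le> dd r (z + t *\<^sub>R \<nu>) \<nu>" using M\<delta> \<nu>(2) by linarith
    then have "t1 * (c / 2) \<le> t1 * dd r (z + t *\<^sub>R \<nu>) \<nu>" using t1 by (intro mult_left_mono) auto
    moreover have "t1 * (c / 2) = - r z" using c rneg by (simp add: t1_def)
    ultimately have "z + t1 *\<^sub>R \<nu> \<notin> \<Omega>" using t(3) Omega_eq by auto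
    then have "closed_segment z (z + t1 *\<^sub>R \<nu>) \<inter> frontier \<Omega> \<noteq> {}"
      using z by (intro connected_Int_frontier) auto
    then obtain p where p: "p \<in> closed_segment z (z + t1 *\<^sub>R \<nu>)" "p \<in> frontier \<Omega>" by blast
    have "norm (z - p) \<le> norm (z - (z + t1 *\<^sub>R \<nu>))"
      using segment_bound[OF p(1)] by (simp add: norm_minus_commute)
    also have "\<dots> = t1" using t1 \<nu>(1) by simp
    finally show ?thesis using p(2) unfolding t1_def by blast
  qed
  then show ?thesis
    using e1 c \<delta> by (intro exI[of _ "min \<epsilon>1 (c * \<delta> / 2)"] conjI exI[of _ "2 / c"]) auto
qed

text \<open>At a frontier point \<open>p\<close> at distance O(|r z|), split \<open>X\<close> into a
  tangential part \<open>T\<close> and a part \<open>V\<close> of size O(|\<langle>\<partial>r(p),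
  X\<rangle>|). The Levi form is nonnegative on \<open>T\<close>, and bounded third derivatives
  carry the estimate from \<open>p\<close> to \<open>z\<close>.\<close>

lemma levi_lower_bound:
  assumes levi: "\<And>p X. p \<in> frontier \<Omega> \<Longrightarrow> del_pair r p X = 0 \<Longrightarrow> 0 \<le> Re (levi_form r p X)"
  shows "\<exists>\<epsilon>>0. \<exists>K>0. \<forall>z\<in>\<Omega>. \<bar>r z\<bar> < \<epsilon> \<longrightarrow>
    (\<forall>X. - K * (\<bar>r z\<bar> * norm X + cmod (del_pair r z X)) * norm X \<le> Re (levi_form r z X))"
proof -
  obtain c where c: "c > 0" "\<And>p. p \<in> frontier \<Omega> \<Longrightarrow> \<exists>\<nu>. norm \<nu> = 1 \<and> c \<le> dd r p \<nu>"
    using frontier_direction by blast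
  obtain \<epsilon> K1 where e: "\<epsilon> > 0" and K1: "K1 > 0" and
    near: "\<And>z. z \<in> \<Omega> \<Longrightarrow> \<bar>r z\<bar> < \<epsilon> \<Longrightarrow> \<exists>p\<in>frontier \<Omega>. norm (z - p) \<le> K1 * \<bar>r z\<bar>"
    using near_frontier_point by blast
  \<comment> \<open>Bounds \<open>M * (2 * norm X + norm V) * norm V\<close> by means of
    \<open>norm V \<le> 2 / c * cmod a\<close> and \<open>cmod a \<le> M * norm X\<close>.\<close>
  define K2 where "K2 = M * (2 + M * (2 / c)) * (2 / c)"
  have K2: "K2 > 0" using c M_pos by (auto simp: K2_def intro!: mult_pos_pos add_pos_pos divide_pos_pos)
  define K where "K = K2 + (K2 * M * K1 + M * K1)"
  have K: "K > 0" "K2 \<le> K" "K2 * M * K1 + M * K1 \<le> K"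
    using K2 M_pos K1 by (auto simp: K_def intro!: add_pos_pos add_nonneg_nonneg)
  have main: "- K * (\<bar>r z\<bar> * norm X + cmod (del_pair r z X)) * norm X \<le> Re (levi_form r z X)"
    if z: "z \<in> \<Omega>" and rz: "\<bar>r z\<bar> < min \<epsilon> (d / K1)" for z X
  proof -
    obtain p where p: "p \<in> frontier \<Omega>" "norm (z - p) \<le> K1 * \<bar>r z\<bar>" using near[OF z] rz by auto
    define h where "h = z - p"
    have zh: "z = p + h" by (simp add: h_def)
    have hK: "norm h \<le> K1 * \<bar>r z\<bar>" using p(2) by (simp add: h_def)
    also have "\<dots> \<le> d" using rz K1 by (simp add: field_simps)
    finally have hd: "norm h \<le> d" .
    have pc: "p \<in> closure \<Omega>" using p(1) by (simp add: frontier_def)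
    have zc: "z \<in> closure \<Omega>" using z closure_subset by blast
    note pU = in_U[OF pc] and zU = in_U[OF zc]
    note l = linear_dd2[OF pU] linear_dd2_left[OF pU]
    obtain \<nu> where \<nu>: "norm \<nu> = 1" "c \<le> dd r p \<nu>" using c(2)[OF p(1)] by blast
    have c2: "c / 2 \<le> cmod (del_pair r p \<nu>)"
      using \<nu>(2) dd_del_pair[OF linear_dd[OF pU], of \<nu>] complex_Re_le_cmod[of "del_pair r p \<nu>"] by linarith
    define a where "a = del_pair r p X"
    define V where "V = (a / del_pair r p \<nu>) *s \<nu>"
    have nV: "norm V \<le> 2 / c * cmod a"
    proof -
      have "norm V = cmod a / cmod (del_pair r p \<nu>)" by (simp add: V_def norm_cscale norm_divide \<nu>(1))
      also have "\<dots> \<le> cmod a / (c / 2)" using c2 c by (intro divide_left_mono mult_pos_pos) auto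
      finally show ?thesis by (simp add: field_simps)
    qed
    define T where "T = X - V"
    have XT: "X = T + V" by (simp add: T_def)
    have dV: "del_pair r p V = a" using c2 c by (auto simp: V_def del_pair_scale)
    have "del_pair r p X = del_pair r p T + del_pair r p V" unfolding XT by (rule del_pair_add)
    then have "del_pair r p T = 0" using dV by (simp add: a_def)
    then have LT: "0 \<le> Re (levi_form r p T)" using levi p(1) by blast
    have aX: "cmod a \<le> M * norm X"
      unfolding a_def by (rule norm_del_pair_le[OF linear_dd[OF pU]]) (rule dd_M0[OF pc])
    have VX: "norm V \<le> M * (2 / c) * norm X"
      using order_trans[OF nV mult_left_mono[OF aX, of "2 / c"]] c by (simp add: mult_ac)
    \<comment> \<open>The factor 2 fits \<open>levi_form_dd2\<close>: two such differences, for
      \<open>X\<close> and \<open>\<i> *s X\<close>, are added and divided by 4.\<close>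
    have D: "\<bar>dd2 r p X' X' - dd2 r p (X' - V') (X' - V')\<bar> \<le> 2 * (K2 * norm X * cmod a)"
      if n: "norm X' = norm X" "norm V' = norm V" for X' V'
    proof -
      have "dd2 r p X' X' - dd2 r p (X' - V') (X' - V') = dd2 r p X' V' + dd2 r p V' X' - dd2 r p V' V'"
        by (simp add: linear_diff[OF l(1)] linear_diff[OF l(2)])
      also have "\<bar>\<dots>\<bar> \<le> M * norm X * norm V + M * norm V * norm X + M * norm V * norm V"
        using dd2_M0[OF pc, of X' V'] dd2_M0[OF pc, of V' X'] dd2_M0[OF pc, of V' V'] unfolding n by linarith
      also have "\<dots> = M * (2 * norm X + norm V) * norm V" by (simp add: algebra_simps)
      also have "\<dots> \<le> M * (2 * norm X + M * (2 / c) * norm X) * (2 / c * cmod a)"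
        using VX nV M_pos c by (intro mult_mono add_left_mono) auto
      also have "\<dots> = K2 * norm X * cmod a" by (simp add: K2_def algebra_simps)
      also have "\<dots> \<le> 2 * (K2 * norm X * cmod a)" using K2 by simp
      finally show ?thesis .
    qed
    have iT: "\<i> *s T = \<i> *s X - \<i> *s V" by (simp add: T_def vec_eq_iff algebra_simps)
    have Lp: "- (K2 * norm X * cmod a) \<le> Re (levi_form r p X)"
      using D[of X V] D[of "\<i> *s X" "\<i> *s V"] LT
      unfolding levi_form_dd2[OF C2_function_axioms pU] iT T_def[symmetric] by (simp add: norm_cscale)
    have Lz: "Re (levi_form r p X) - M * norm h * norm X * norm X \<le> Re (levi_form r z X)"
    proof -
      have n: "norm (\<i> *s X) = norm X" by (simp add: norm_cscale)
      define P where "P = M * norm h * norm X * norm X"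
      have "0 \<le> P" using M_pos by (simp add: P_def)
      then show ?thesis
        unfolding levi_form_dd2[OF C2_function_axioms pU] levi_form_dd2[OF C2_function_axioms zU]
        using dd2_lipschitz[OF pc hd, of X X] dd2_lipschitz[OF pc hd, of "\<i> *s X" "\<i> *s X"]
        unfolding zh[symmetric] n P_def[symmetric] by (simp add: abs_le_iff field_simps)
    qed
    have "cmod (del_pair r z X - del_pair r p X) \<le> (M * norm h) * norm X"
      by (rule del_pair_diff_le[OF linear_dd[OF zU] linear_dd[OF pU]])
         (use dd_lipschitz[OF pc hd] zh in simp)
    \<comment> \<open>Replacing the pairing at \<open>p\<close> by the one at \<open>z\<close> costs
      O(|r z|) times the norm of \<open>X\<close>, which the first term of the estimate
      accommodates.\<close>
    then have "cmod a \<le> cmod (del_pair r z X) + M * norm h * norm X"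
      unfolding a_def using norm_triangle_sub[of "del_pair r p X" "del_pair r z X"]
      by (simp add: norm_minus_commute)
    then have "K2 * norm X * cmod a \<le> K2 * norm X * (cmod (del_pair r z X) + M * norm h * norm X)"
      using K2 by (intro mult_left_mono) auto
    then have "- Re (levi_form r z X) \<le>
        K2 * (cmod (del_pair r z X) * norm X) + (K2 * M + M) * norm h * (norm X * norm X)"
      using Lp Lz by (simp add: algebra_simps)
    also have "\<dots> \<le> K2 * (cmod (del_pair r z X) * norm X) + (K2 * M + M) * (K1 * \<bar>r z\<bar>) * (norm X * norm X)"
      using hK K2 M_pos by (intro add_left_mono mult_right_mono mult_left_mono) auto
    also have "\<dots> = K2 * (cmod (del_pair r z X) * norm X) + (K2 * M * K1 + M * K1) * (\<bar>r z\<bar> * norm X * norm X)"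
      by (simp add: algebra_simps)
    also have "\<dots> \<le> K * (cmod (del_pair r z X) * norm X) + K * (\<bar>r z\<bar> * norm X * norm X)"
      using K by (intro add_mono mult_right_mono) auto
    finally show ?thesis by (simp add: algebra_simps)
  qed
  show ?thesis
    using e K1 d_pos K(1) main by (intro exI[of _ "min \<epsilon> (d / K1)"] conjI exI[of _ K]) auto
qed

section \<open>Estimates for a single disc\<close>

lemma disc_estimate:
  assumes z: "z \<in> \<Omega>" and B: "0 < B" "norm W \<le> B" "norm Y \<le> B"
    and E: "\<And>\<zeta>. cmod \<zeta> < 1/2 \<Longrightarrow> norm (E \<zeta>) \<le> B * cmod \<zeta> ^ 3"
    and inO: "\<And>\<zeta>. cmod \<zeta> < 1/2 \<Longrightarrow> z + (\<zeta> *s W + (\<zeta>\<^sup>2 *s Y + E \<zeta>)) \<in> \<Omega>"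
    and \<rho>: "0 < \<rho>" "\<rho> < 1/2" "3 * B * \<rho> \<le> d"
  shows "\<rho> * cmod (del_pair r z W) + Re (levi_form r z W) * \<rho>\<^sup>2
    \<le> \<bar>r z\<bar> + (M * B + 4 * M * B\<^sup>2 + 27 * M * B ^ 3) * \<rho> ^ 3"
proof -
  define a where "a = del_pair r z W"
  define b where "b = del_pair r z Y"
  define L where "L = Re (levi_form r z W)"
  define q where "q = hol_hess r z W"
  \<comment> \<open>The three summands come from the first-order effect of \<open>E\<close>, from
    half of the Hessian cross terms, and from the Taylor remainder at displacement at most
    \<open>3 * B * \<rho>\<close>.\<close>
  define C where "C = M * B + 4 * M * B\<^sup>2 + 27 * M * B ^ 3"
  have zc: "z \<in> closure \<Omega>" using z closure_subset by blast
  note zU = in_U[OF zc]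
  note l = linear_dd2[OF zU] linear_dd2_left[OF zU] and l1 = linear_dd[OF zU]
  have main: "r z + 2 * Re (\<zeta> * a) + 2 * Re (\<zeta>\<^sup>2 * b) + L * \<rho>\<^sup>2 + Re (q * \<zeta>\<^sup>2) - C * \<rho> ^ 3 \<le> 0"
    if n: "cmod \<zeta> = \<rho>" for \<zeta>
  proof -
    define k where "k = \<zeta>\<^sup>2 *s Y + E \<zeta>"
    let ?x = "\<zeta> *s W"
    have E3: "norm (E \<zeta>) \<le> B * \<rho> ^ 3" using E[of \<zeta>] \<rho> n by simp
    have r32: "\<rho> ^ 3 \<le> \<rho>\<^sup>2" "\<rho>\<^sup>2 \<le> \<rho>" using \<rho> by (auto simp: power3_eq_cube power2_eq_square mult_left_le)
    have nx: "norm ?x \<le> B * \<rho>" using B(2) \<rho> n by (simp add: norm_cscale mult.commute)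
    have "norm (\<zeta>\<^sup>2 *s Y) \<le> B * \<rho>\<^sup>2" using B(3) n by (simp add: norm_cscale norm_power mult.commute mult_right_mono)
    moreover have "norm (E \<zeta>) \<le> B * \<rho>\<^sup>2" using E3 mult_left_mono[OF r32(1), of B] B by linarith
    ultimately have nk: "norm k \<le> 2 * B * \<rho>\<^sup>2" unfolding k_def using norm_triangle_ineq[of "\<zeta>\<^sup>2 *s Y" "E \<zeta>"] by linarith
    also have "\<dots> \<le> 2 * B * \<rho>" using r32 B by (intro mult_left_mono) auto
    finally have nk': "norm k \<le> 2 * B * \<rho>" .
    then have nh: "norm (?x + k) \<le> 3 * B * \<rho>" using nx norm_triangle_ineq[of ?x k] by linarith
    have "r (z + (?x + k)) < 0" using inO[of \<zeta>] \<rho> n Omega_eq by (auto simp: k_def)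
    moreover have "r z + dd r z (?x + k) + dd2 r z (?x + k) (?x + k) / 2 - M * norm (?x + k) ^ 3 \<le> r (z + (?x + k))"
      using Taylor3_bound[OF zc] nh \<rho>(3) by fastforce
    moreover have "dd r z (?x + k) = 2 * Re (\<zeta> * a) + 2 * Re (\<zeta>\<^sup>2 * b) + dd r z (E \<zeta>)"
      unfolding k_def linear_add[OF l1] dd_del_pair[OF l1, of "_ *s _"] del_pair_scale a_def b_def by simp
    moreover have "\<bar>dd r z (E \<zeta>)\<bar> \<le> M * B * \<rho> ^ 3"
      using dd_M0[OF zc, of "E \<zeta>"] mult_left_mono[OF E3 less_imp_le[OF M_pos]] by (simp add: mult.assoc)
    moreover have "M * norm (?x + k) ^ 3 \<le> 27 * M * B ^ 3 * \<rho> ^ 3"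
    proof -
      have "M * norm (?x + k) ^ 3 \<le> M * (3 * B * \<rho>) ^ 3"
        using nh M_pos by (intro mult_left_mono power_mono) auto
      then show ?thesis by (simp add: power_mult_distrib)
    qed
    moreover have "\<bar>dd2 r z (?x + k) (?x + k) - dd2 r z ?x ?x\<bar> \<le> 8 * M * B\<^sup>2 * \<rho> ^ 3"
    proof -
      have "dd2 r z (?x + k) (?x + k) - dd2 r z ?x ?x = dd2 r z ?x k + dd2 r z k ?x + dd2 r z k k"
        by (simp add: linear_add[OF l(1)] linear_add[OF l(2)])
      also have "\<bar>\<dots>\<bar> \<le> M * norm ?x * norm k + M * norm k * norm ?x + M * norm k * norm k"
        using dd2_M0[OF zc, of ?x k] dd2_M0[OF zc, of k ?x] dd2_M0[OF zc, of k k] by linarith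
      also have "\<dots> = M * (2 * norm ?x + norm k) * norm k" by (simp add: algebra_simps)
      also have "\<dots> \<le> M * (2 * (B * \<rho>) + 2 * B * \<rho>) * (2 * B * \<rho>\<^sup>2)"
        using nx nk nk' M_pos B \<rho> by (intro mult_mono add_mono mult_left_mono) auto
      also have "\<dots> = 8 * M * B\<^sup>2 * \<rho> ^ 3" by (simp add: power2_eq_square power3_eq_cube)
      finally show ?thesis .
    qed
    moreover have "dd2 r z ?x ?x / 2 = L * \<rho>\<^sup>2 + Re (q * \<zeta>\<^sup>2)"
      using dd2_cscale[OF C2_function_axioms zU, of \<zeta> W] n by (simp add: L_def q_def)
    moreover have "C * \<rho> ^ 3 = M * B * \<rho> ^ 3 + 8 * M * B\<^sup>2 * \<rho> ^ 3 / 2 + 27 * M * B ^ 3 * \<rho> ^ 3"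
      by (simp add: C_def algebra_simps)
    ultimately show ?thesis by argo
  qed
  \<comment> \<open>A unimodular factor that makes the pairing real and nonnegative. For
    \<open>a = 0\<close> any unimodular number will do.\<close>
  define e where "e = (if a = 0 then 1 else cnj a / of_real (cmod a))"
  have e: "cmod e = 1" "e * a = of_real (cmod a)"
    by (auto simp: e_def norm_divide complex_norm_square[symmetric] power2_eq_square mult.commute)
  define \<zeta> where "\<zeta> = of_real \<rho> * e"
  have nz: "cmod \<zeta> = \<rho>" "cmod (\<i> * \<zeta>) = \<rho>"
    using \<rho> e by (auto simp: \<zeta>_def norm_mult)
  have za: "\<zeta> * a = of_real (\<rho> * cmod a)" "\<i> * \<zeta> * a = \<i> * of_real (\<rho> * cmod a)"
    using e by (simp_all add: \<zeta>_def mult.assoc)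
  have sq: "(\<i> * \<zeta>)\<^sup>2 = - (\<zeta>\<^sup>2)" by (simp add: power_mult_distrib)
  have "r z + 2 * (\<rho> * cmod a) + 2 * Re (\<zeta>\<^sup>2 * b) + L * \<rho>\<^sup>2 + Re (q * \<zeta>\<^sup>2) - C * \<rho> ^ 3 \<le> 0"
    using main[OF nz(1)] unfolding za by simp
  \<comment> \<open>At \<i>\<zeta> the first-order term is purely imaginary and drops out, while
    both terms in \<zeta>^2 change sign.\<close>
  moreover have "r z - 2 * Re (\<zeta>\<^sup>2 * b) + L * \<rho>\<^sup>2 - Re (q * \<zeta>\<^sup>2) - C * \<rho> ^ 3 \<le> 0"
    using main[OF nz(2)] unfolding za sq by simp
  ultimately have "2 * r z + 2 * (\<rho> * cmod a) + 2 * (L * \<rho>\<^sup>2) - 2 * (C * \<rho> ^ 3) \<le> 0" by linarith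
  then show ?thesis unfolding a_def L_def C_def by linarith
qed

text \<open>With \<rho> proportional to |r|^(1/3) every term of \<open>disc_estimate\<close> except
  \<rho>A is O(|r|) or absorbed, and division by \<rho> leaves |r|^(2/3). Away from the boundary the
  Cauchy bound on the derivative suffices.\<close>

lemma disc_derivative_bound:
  assumes levi: "\<And>p X. p \<in> frontier \<Omega> \<Longrightarrow> del_pair r p X = 0 \<Longrightarrow> 0 \<le> Re (levi_form r p X)"
  shows "\<exists>K>0. \<forall>f W. (\<forall>j. (\<lambda>w. f w $ j) holomorphic_on ball 0 1) \<and> f ` ball 0 1 \<subseteq> \<Omega> \<and>
     (\<forall>j. deriv (\<lambda>w. f w $ j) 0 = W $ j) \<longrightarrow>
     cmod (del_pair r (f 0) W) \<le> K * \<bar>r (f 0)\<bar> powr (2/3)"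
proof -
  obtain \<epsilon> K1 where e0: "\<epsilon> > 0" and K1: "K1 > 0" and
    lev: "\<And>z X. z \<in> \<Omega> \<Longrightarrow> \<bar>r z\<bar> < \<epsilon> \<Longrightarrow>
       - K1 * (\<bar>r z\<bar> * norm X + cmod (del_pair r z X)) * norm X \<le> Re (levi_form r z X)"
    using levi_lower_bound[OF levi] by blast
  obtain R where R: "R > 0" "\<And>x. x \<in> \<Omega> \<Longrightarrow> norm x \<le> R"
    using bounded_Omega bounded_pos by metis
  define B where "B = real CARD('n) * (192 * R)"
  have B: "B > 0" using R by (simp add: B_def)
  define C where "C = M * B + 4 * M * B\<^sup>2 + 27 * M * B ^ 3"
  have C: "C > 0" using B M_pos by (auto simp: C_def intro!: add_pos_pos)
  define K2 where "K2 = K1 * (B\<^sup>2 + B)"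
  have K2: "K2 > 0" using B K1 by (auto simp: K2_def intro!: mult_pos_pos add_pos_pos)
  \<comment> \<open>In turn: \<rho> stays below 1/2, the displacements stay within \<open>d\<close>,
    and \<open>K2 * \<rho> \<le> 1 / 2\<close>.\<close>
  define \<rho>0 where "\<rho>0 = Min {1/3, d / (3 * B), 1 / (2 * K2)}"
  have \<rho>0: "\<rho>0 > 0" "\<rho>0 \<le> 1/3" "\<rho>0 \<le> d / (3 * B)" "\<rho>0 \<le> 1 / (2 * K2)"
    using d_pos B K2 by (auto simp: \<rho>0_def)
  define \<epsilon>1 where "\<epsilon>1 = min \<epsilon> 1"
  have \<epsilon>1: "\<epsilon>1 > 0" using e0 by (simp add: \<epsilon>1_def)
  define K3 where "K3 = 2 * (1 + K2 + C) / \<rho>0"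
  define K4 where "K4 = M * B / \<epsilon>1 powr (2/3)"
  have K34: "K3 > 0" "K4 > 0" using \<rho>0 K2 C M_pos B \<epsilon>1 by (auto simp: K3_def K4_def intro!: divide_pos_pos add_pos_pos)
  have main: "cmod (del_pair r (f 0) W) \<le> (K3 + K4) * \<bar>r (f 0)\<bar> powr (2/3)"
    if hol: "\<And>j. (\<lambda>w. f w $ j) holomorphic_on ball 0 1" and img: "f ` ball 0 1 \<subseteq> \<Omega>"
      and der: "\<And>j. deriv (\<lambda>w. f w $ j) 0 = W $ j"
    for f :: "complex \<Rightarrow> complex^'n" and W
  proof -
    define z where "z = f 0"
    have z: "z \<in> \<Omega>" using img by (auto simp: z_def)
    then have zc: "z \<in> closure \<Omega>" using closure_subset by blast
    have rneg: "r z < 0" using z Omega_eq by auto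
    have fR: "norm (f w) \<le> R" if "w \<in> ball 0 1" for w using that img R(2) by blast
    have W: "(\<chi> j. deriv (\<lambda>w. f w $ j) 0) = W" using der by (simp add: vec_eq_iff)
    define Y where "Y = (\<chi> j. (deriv ^^ 2) (\<lambda>w. f w $ j) 0 / 2)"
    define E where "E \<zeta> = f \<zeta> - (z + \<zeta> *s W + \<zeta>\<^sup>2 *s Y)" for \<zeta>
    note T = disc_Taylor[OF hol fR, unfolded W, folded Y_def B_def z_def]
    have nW: "norm W \<le> B" and nY: "norm Y \<le> B" using T(1,2) by auto
    have nE: "norm (E \<zeta>) \<le> B * cmod \<zeta> ^ 3" if "cmod \<zeta> < 1/2" for \<zeta>
      using T(3)[OF _ that] by (auto simp: E_def)
    have inO: "z + (\<zeta> *s W + (\<zeta>\<^sup>2 *s Y + E \<zeta>)) \<in> \<Omega>" if "cmod \<zeta> < 1/2" for \<zeta>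
      using that img by (auto simp: E_def image_subset_iff)
    define A where "A = cmod (del_pair r z W)"
    define x where "x = \<bar>r z\<bar> powr (1/3)"
    have x0: "x > 0" using rneg by (simp add: x_def)
    have x3: "x ^ 3 = \<bar>r z\<bar>" using rneg by (simp add: x_def powr_powr flip: powr_numeral)
    have x2: "x\<^sup>2 = \<bar>r z\<bar> powr (2/3)" using rneg by (simp add: x_def powr_powr flip: powr_numeral)
    have A0: "A \<ge> 0" by (simp add: A_def)
    have AM: "A \<le> M * B"
    proof -
      have "A \<le> M * norm W" unfolding A_def
        by (rule norm_del_pair_le[OF linear_dd[OF in_U[OF zc]]]) (rule dd_M0[OF zc])
      then show ?thesis using mult_left_mono[OF nW less_imp_le[OF M_pos]] by linarith
    qed
    have "A \<le> (K3 + K4) * x\<^sup>2"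
    proof (cases "\<bar>r z\<bar> < \<epsilon>1")
      case True
      then have small: "\<bar>r z\<bar> < \<epsilon>" "\<bar>r z\<bar> < 1" by (auto simp: \<epsilon>1_def)
      have x1: "x \<le> 1" unfolding x_def using small rneg by (intro powr_le1) auto
      define \<rho> where "\<rho> = \<rho>0 * x"
      have \<rho>le: "\<rho> \<le> \<rho>0" using x0 x1 \<rho>0 by (simp add: \<rho>_def mult_left_le)
      have \<rho>: "0 < \<rho>" "\<rho> < 1/2" using \<rho>0(1,2) x0 \<rho>le by (simp add: \<rho>_def, linarith)
      have "\<rho> \<le> d / (3 * B)" "\<rho> \<le> 1 / (2 * K2)" using \<rho>le \<rho>0 by auto
      then have \<rho>2: "3 * B * \<rho> \<le> d" "K2 * \<rho> \<le> 1 / 2" using B K2 by (auto simp: field_simps)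
      have 1: "\<rho> * A + Re (levi_form r z W) * \<rho>\<^sup>2 \<le> \<bar>r z\<bar> + C * \<rho> ^ 3"
        using disc_estimate[OF z B nW nY nE inO \<rho> \<rho>2(1)] unfolding A_def C_def .
      have "K1 * (\<bar>r z\<bar> * norm W + A) * norm W \<le> K1 * (\<bar>r z\<bar> * B + A) * B"
        using nW K1 A0 B by (intro mult_mono mult_left_mono add_right_mono) auto
      also have "\<dots> \<le> K2 * (\<bar>r z\<bar> + A)"
        using K1 B A0 by (simp add: K2_def power2_eq_square algebra_simps)
      finally have "- (K2 * (\<bar>r z\<bar> + A)) \<le> Re (levi_form r z W)"
        using lev[OF z small(1), of W] unfolding A_def by linarith
      then have "- (K2 * (\<bar>r z\<bar> + A)) * \<rho>\<^sup>2 \<le> Re (levi_form r z W) * \<rho>\<^sup>2" by (intro mult_right_mono) auto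
      then have "\<rho> * A \<le> x ^ 3 + C * \<rho> ^ 3 + K2 * (x ^ 3 + A) * \<rho>\<^sup>2" using 1 unfolding x3 mult_minus_left by linarith
      \<comment> \<open>The part of the Levi bound proportional to \<open>A\<close> is isolated as
        \<open>K2 * \<rho>\<close> times \<open>\<rho> * A\<close>; at most half of the left side,
        it can be absorbed there.\<close>
      also have "\<dots> = x ^ 3 + C * \<rho> ^ 3 + K2 * (x ^ 3 * \<rho>\<^sup>2) + (K2 * \<rho>) * (\<rho> * A)"
        by (simp add: power2_eq_square algebra_simps)
      also have "\<dots> \<le> x ^ 3 + C * x ^ 3 + K2 * (x ^ 3 * 1) + (1 / 2) * (\<rho> * A)"
      proof (intro add_mono mult_left_mono mult_right_mono order_refl)
        have "\<rho> \<le> x" using \<rho>0 x0 by (simp add: \<rho>_def)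
        then show "\<rho> ^ 3 \<le> x ^ 3" using \<rho> by (intro power_mono) auto
        show "\<rho>\<^sup>2 \<le> 1" using \<rho> by (intro power_le_one) auto
      qed (use \<rho>2 C K2 \<rho> A0 x0 in auto)
      finally have "\<rho> * A \<le> 2 * (1 + K2 + C) * x ^ 3" by (simp add: algebra_simps)
      then have "x * (\<rho>0 * A) \<le> x * (2 * (1 + K2 + C) * x\<^sup>2)"
        by (simp add: \<rho>_def power2_eq_square power3_eq_cube mult_ac)
      then have "\<rho>0 * A \<le> 2 * (1 + K2 + C) * x\<^sup>2" using x0 by simp
      then have "A \<le> K3 * x\<^sup>2" using \<rho>0 by (simp add: K3_def field_simps)
      also have "\<dots> \<le> (K3 + K4) * x\<^sup>2" using K34 by (intro mult_right_mono) auto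
      finally show ?thesis .
    next
      case False
      then have "\<epsilon>1 powr (2/3) \<le> x\<^sup>2" unfolding x2 using \<epsilon>1 by (intro powr_mono2) auto
      then have "K4 * \<epsilon>1 powr (2/3) \<le> K4 * x\<^sup>2" using K34 by (intro mult_left_mono) auto
      then have "M * B \<le> K4 * x\<^sup>2" using \<epsilon>1 by (simp add: K4_def)
      also have "\<dots> \<le> (K3 + K4) * x\<^sup>2" using K34 by (intro mult_right_mono) auto
      finally show ?thesis using AM by linarith
    qed
    then show ?thesis unfolding A_def x2 z_def .
  qed
  show ?thesis
    using main K34 by (intro exI[of _ "K3 + K4"]) auto
qed

section \<open>Passage to the infimum over all discs\<close>

lemma kobayashi_ge:
  assumes levi: "\<And>p X. p \<in> frontier \<Omega> \<Longrightarrow> del_pair r p X = 0 \<Longrightarrow> 0 \<le> Re (levi_form r p X)"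
  shows "\<exists>C>0. \<forall>z\<in>\<Omega>. \<forall>X. kobayashi \<Omega> z X \<ge> C * cmod (del_pair r z X) / \<bar>r z\<bar> powr (2/3)"
proof -
  obtain K where K: "K > 0" and bound: "\<And>f W. (\<And>j. (\<lambda>w. f w $ j) holomorphic_on ball 0 1) \<Longrightarrow>
     f ` ball 0 1 \<subseteq> \<Omega> \<Longrightarrow> (\<And>j. deriv (\<lambda>w. f w $ j) 0 = W $ j) \<Longrightarrow>
     cmod (del_pair r (f 0) W) \<le> K * \<bar>r (f 0)\<bar> powr (2/3)"
    using disc_derivative_bound[OF levi] by blast
  have "1 / K * cmod (del_pair r z X) / \<bar>r z\<bar> powr (2/3) \<le> kobayashi \<Omega> z X" if z: "z \<in> \<Omega>" for z X
    unfolding kobayashi_def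
  proof (rule cInf_greatest)
    \<comment> \<open>A small affine disc shows that competitors exist, as a lower bound for
      \<open>Inf\<close> on the reals requires a nonempty set. The added 1 in the denominator of
      \<rho> covers \<open>X = 0\<close>.\<close>
    obtain \<delta> where \<delta>: "\<delta> > 0" "ball z \<delta> \<subseteq> \<Omega>" using open_Omega z openE by blast
    define \<rho> where "\<rho> = \<delta> / (norm X + 1)"
    have \<rho>: "\<rho> > 0" using \<delta> by (simp add: \<rho>_def add_nonneg_pos)
    let ?f = "\<lambda>w. z + (of_real \<rho> * w) *s X"
    have 1: "?f w $ j = z $ j + of_real \<rho> * w * X $ j" for w j by simp
    have "((\<lambda>w. ?f w $ j) has_field_derivative of_real \<rho> * X $ j) (at w)" for w j
      unfolding 1 by (auto intro!: derivative_eq_intros)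
    then have "deriv (\<lambda>w. ?f w $ j) 0 = complex_of_real \<rho> * X $ j" for j by (rule DERIV_imp_deriv)
    moreover have "(\<lambda>w. ?f w $ j) holomorphic_on ball 0 1" for j
      unfolding 1 by (intro holomorphic_intros)
    moreover have "?f ` ball 0 1 \<subseteq> \<Omega>"
    proof safe
      fix w :: complex assume w: "w \<in> ball 0 1"
      have "norm ((of_real \<rho> * w) *s X) = cmod w * (\<rho> * norm X)"
        using \<rho> by (simp add: norm_cscale norm_mult)
      also have "\<dots> \<le> 1 * (\<rho> * norm X)" using w \<rho> by (intro mult_right_mono) auto
      also have "\<dots> < \<rho> * (norm X + 1)" using \<rho> by simp
      also have "\<dots> = \<delta>" unfolding \<rho>_def by (simp add: add_nonneg_eq_0_iff)
      finally show "?f w \<in> \<Omega>" using \<delta>(2) by (auto simp: dist_norm subset_iff)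
    qed
    moreover have "?f 0 = z" by (simp add: vec_eq_iff)
    ultimately have "\<exists>f. (\<forall>j. (\<lambda>w. f w $ j) holomorphic_on ball 0 1) \<and> f ` ball 0 1 \<subseteq> \<Omega> \<and> f 0 = z \<and>
        (\<forall>j. deriv (\<lambda>w. f w $ j) 0 = complex_of_real \<rho> * X $ j)"
      by (intro exI[of _ ?f] conjI allI)
    then show "{1 / l | l. l > 0 \<and> (\<exists>f. (\<forall>j. (\<lambda>w. f w $ j) holomorphic_on ball 0 1) \<and> f ` ball 0 1 \<subseteq> \<Omega> \<and>
        f 0 = z \<and> (\<forall>j. deriv (\<lambda>w. f w $ j) 0 = complex_of_real l * X $ j))} \<noteq> {}"
      using \<rho> by blast
  next
    fix v
    assume "v \<in> {1 / l | l. l > 0 \<and> (\<exists>f. (\<forall>j. (\<lambda>w. f w $ j) holomorphic_on ball 0 1) \<and> f ` ball 0 1 \<subseteq> \<Omega> \<and>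
        f 0 = z \<and> (\<forall>j. deriv (\<lambda>w. f w $ j) 0 = complex_of_real l * X $ j))}"
    then obtain l and f :: "complex \<Rightarrow> complex^'n" where l: "v = 1 / l" "l > 0" and f: "\<And>j. (\<lambda>w. f w $ j) holomorphic_on ball 0 1"
      "f ` ball 0 1 \<subseteq> \<Omega>" "f 0 = z" "\<And>j. deriv (\<lambda>w. f w $ j) 0 = complex_of_real l * X $ j" by blast
    have "cmod (del_pair r (f 0) (of_real l *s X)) \<le> K * \<bar>r (f 0)\<bar> powr (2/3)"
      using f by (intro bound) auto
    then have "l * cmod (del_pair r z X) \<le> K * \<bar>r z\<bar> powr (2/3)"
      unfolding f(3) using l(2) by (simp add: del_pair_scale norm_mult)
    moreover have "\<bar>r z\<bar> powr (2/3) > 0" using z Omega_eq by auto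
    ultimately show "1 / K * cmod (del_pair r z X) / \<bar>r z\<bar> powr (2/3) \<le> v"
      unfolding l(1) using l(2) K by (simp add: field_simps)
  qed
  then show ?thesis using K by (intro exI[of _ "1 / K"]) auto
qed

end

theorem theorem2p6:
  shows
   "(\<forall>(\<Omega> :: (complex^'n) set) r U C \<alpha>.
       open \<Omega> \<and> connected \<Omega> \<and> \<Omega> \<noteq> {} \<and> bounded \<Omega> \<and> defining_function 2 r U \<Omega> \<and>
       C > 0 \<and> \<alpha> > 1/2 \<and>
       (\<forall>z\<in>\<Omega>. \<forall>X. kobayashi \<Omega> z X \<ge> C * cmod (del_pair r z X) / \<bar>r z\<bar> powr \<alpha>)
       \<longrightarrow> pseudoconvex \<Omega>)
    \<and>
    (\<forall>(\<Omega> :: (complex^'n) set) r U.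
       open \<Omega> \<and> connected \<Omega> \<and> \<Omega> \<noteq> {} \<and> bounded \<Omega> \<and> pseudoconvex \<Omega> \<and>
       defining_function 3 r U \<Omega>
       \<longrightarrow> (\<exists>C>0. \<forall>z\<in>\<Omega>. \<forall>X.
              kobayashi \<Omega> z X \<ge> C * cmod (del_pair r z X) / \<bar>r z\<bar> powr (2/3)))"
proof (intro conjI allI impI; elim conjE)
  fix \<Omega> :: "(complex^'n) set" and r U and C \<alpha> :: real
  assume "defining_function 2 r U \<Omega>" "C > 0" "\<alpha> > 1/2"
    "\<forall>z\<in>\<Omega>. \<forall>X. kobayashi \<Omega> z X \<ge> C * cmod (del_pair r z X) / \<bar>r z\<bar> powr \<alpha>"
  then show "pseudoconvex \<Omega>"
    using C2_domain.pseudoconvex_of_kobayashi_lower_bound[of r U \<Omega> C \<alpha>] C2_domain_iff by blast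
next
  fix \<Omega> :: "(complex^'n) set" and r U
  assume bdd: "bounded \<Omega>" and psc: "pseudoconvex \<Omega>" and df: "defining_function 3 r U \<Omega>"
  have C3f: "C3_function r U" using df by (simp add: defining_function_def C3_function_def)
  then interpret C3_function r U .
  have "defining_function 2 r U \<Omega>"
    using df C2 unfolding defining_function_def by blast
  then have C2d: "C2_domain r U \<Omega>" using C2_domain_iff by blast
  \<comment> \<open>Pseudoconvexity may be witnessed by a defining function other than
    \<open>r\<close>, so the Levi condition has to be transferred to \<open>r\<close> before
    \<open>kobayashi_ge\<close> applies.\<close>
  obtain r' U' where r': "C2_domain r' U' \<Omega>"
    "\<And>p X. p \<in> frontier \<Omega> \<Longrightarrow> del_pair r' p X = 0 \<Longrightarrow> 0 \<le> Re (levi_form r' p X)"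
    using psc C2_domain_iff unfolding pseudoconvex_def by blast
  obtain d M where "C3_domain_bounds r U \<Omega> d M" using ex_C3_domain_bounds[OF C3f C2d bdd] by blast
  then show "\<exists>C>0. \<forall>z\<in>\<Omega>. \<forall>X. kobayashi \<Omega> z X \<ge> C * cmod (del_pair r z X) / \<bar>r z\<bar> powr (2/3)"
    using C3_domain_bounds.kobayashi_ge levi_condition_transfer[OF C2d r'(1)] r'(2) by blast
qed

end
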